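(* Let $N\in\mathbb{N}$, $N\ge 1$, and let $\varphi\in H^\infty(\mathbb{T}^N)$. Let $M_\varphi^*$ be the Hilbert space adjoint of the multiplication operator $M_\varphi:H^2(\mathbb{T}^N)\to H^2(\mathbb{T}^N)$, $M_\varphi f=\varphi f$. The following statements are equivalent: (i) there exists a countable family $\{g_i\}_{i\in I}$ in $H^2(\mathbb{T}^N)$ such that $\{(M_\varphi^* )^n g_i\}_{i\in I,\,n\ge 0}$ is a frame for $H^2(\mathbb{T}^N)$; (ii) $|\varphi(\zeta)|<1$ for almost every $\zeta\in\mathbb{T}^N$. Furthermore, if these equivalent conditions hold, then the index set $I$ of any family as in (i) must be infinite.
   Context: $\mathbb{T}^N=\{\zeta\in\mathbb{C}^N: |\zeta_j|=1 \text{ for all } j\}$ carries its normalized Haar (Lebesgue) measure $d\zeta$. For $f\in L^2(\mathbb{T}^N)$ and $\alpha\in\mathbb{Z}^N$, $\widehat f(\alpha)=\int_{\mathbb{T}^N} f(\zeta)\zeta^{-\alpha}\,d\zeta$, where $\zeta^\alpha=\zeta_1^{\alpha_1}\cdots\zeta_N^{\alpha_N}$. $H^2(\mathbb{T}^N)$ is the closed subspace of $L^2(\mathbb{T}^N)$ of those $f$ with $\widehat f(\alpha)=0$ for all $\alpha\in\mathbb{Z}^N\setminus\mathbb{N}_0^N$, and $H^\infty(\mathbb{T}^N)=L^\infty(\mathbb{T}^N)\cap H^2(\mathbb{T}^N)$. The adjoint is given by $M_\varphi^* f=\mathbf{P}(\overline{\varphi}f)$, where $\mathbf{P}$ is the orthogonal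 projection of $L^2(\mathbb{T}^N)$ onto $H^2(\mathbb{T}^N)$. A countable family $\{x_j\}_{j\in\Omega}$ in a Hilbert space $\mathcal{H}$ is a frame for $\mathcal{H}$ if there are constants $A,B>0$ with $A\|y\|^2\le\sum_{j\in\Omega}|\langle y,x_j\rangle|^2\le B\|y\|^2$ for all $y\in\mathcal{H}$. *)

theory Defs
  imports "HOL-Probability.Probability"
begin

text \<open>Elements of \<open>L\<^sup>2(M)\<close> are represented by Borel measurable, square-integrable functions. Two
  functions represent the same element iff they agree almost everywhere; all notions below depend
  only on these classes.\<close>

definition L2_space :: "'a measure \<Rightarrow> ('a \<Rightarrow> complex) set" where
  "L2_space M = {f \<in> borel_measurable M. integrable M (\<lambda>x. (cmod (f x))\<^sup>2)}"

definition L2_inner :: "'a measure \<Rightarrow> ('a \<Rightarrow> complex) \<Rightarrow> ('a \<Rightarrow> complex) \<Rightarrow> complex" where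
  "L2_inner M f g = (LINT x|M. f x * cnj (g x))"

definition L2_norm :: "'a measure \<Rightarrow> ('a \<Rightarrow> complex) \<Rightarrow> real" where
  "L2_norm M f = sqrt (LINT x|M. (cmod (f x))\<^sup>2)"

text \<open>The Hilbert space adjoint of a bounded operator \<open>T\<close> on a closed subspace \<open>H\<close> of \<open>L\<^sup>2(M)\<close>,
  given by \<open>\<langle>T f, g\<rangle> = \<langle>f, T\<^sup>* g\<rangle>\<close>. This determines \<open>T\<^sup>* g\<close> only up to equality almost everywhere;
  the choice operator picks one representative.\<close>

definition L2_adjoint ::
  "'a measure \<Rightarrow> ('a \<Rightarrow> complex) set \<Rightarrow> (('a \<Rightarrow> complex) \<Rightarrow> ('a \<Rightarrow> complex))
     \<Rightarrow> ('a \<Rightarrow> complex) \<Rightarrow> ('a \<Rightarrow> complex)" where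
  "L2_adjoint M H T g = (SOME h. h \<in> H \<and> (\<forall>f\<in>H. L2_inner M (T f) g = L2_inner M f h))"

definition is_frame ::
  "'a measure \<Rightarrow> ('a \<Rightarrow> complex) set \<Rightarrow> 'j set \<Rightarrow> ('j \<Rightarrow> 'a \<Rightarrow> complex) \<Rightarrow> bool" where
  "is_frame M H J x \<longleftrightarrow> countable J \<and> (\<forall>j\<in>J. x j \<in> H) \<and>
     (\<exists>A>0. \<exists>B>0. \<forall>y\<in>H.
        (\<lambda>j. (cmod (L2_inner M y (x j)))\<^sup>2) summable_on J \<and>
        A * (L2_norm M y)\<^sup>2 \<le> (\<Sum>\<^sub>\<infinity>j\<in>J. (cmod (L2_inner M y (x j)))\<^sup>2) \<and>
        (\<Sum>\<^sub>\<infinity>j\<in>J. (cmod (L2_inner M y (x j)))\<^sup>2) \<le> B * (L2_norm M y)\<^sup>2)"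

text \<open>Normalized arc length on the unit circle, and its \<open>N\<close>-fold product. Points of the torus are
  functions on \<open>{..<N}\<close> (extensional: \<open>undefined\<close> elsewhere).\<close>

definition circle_measure :: "complex measure" where
  "circle_measure =
     distr (uniform_measure lborel {0..1::real}) (restrict_space borel (sphere 0 1))
       (\<lambda>t. cis (2 * pi * t))"

definition torus :: "nat \<Rightarrow> (nat \<Rightarrow> complex) measure" where
  "torus N = PiM {..<N} (\<lambda>_. circle_measure)"

lemma space_torus: "space (torus N) = (\<Pi>\<^sub>E j\<in>{..<N}. {z. cmod z = 1})"
  by (simp add: torus_def circle_measure_def space_PiM space_restrict_space sphere_def)

lemma prob_space_circle_measure: "prob_space circle_measure"
proof -
  have U: "prob_space (uniform_measure lborel {0..1::real})"
    by (rule prob_space_uniform_measure) simp_all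
  have "(\<lambda>t. cis (2 * pi * t)) \<in> borel_measurable borel"
    by (intro borel_measurable_continuous_onI continuous_intros)
  then have "(\<lambda>t. cis (2 * pi * t)) \<in> borel_measurable (uniform_measure lborel {0..1::real})"
    by simp
  then have "(\<lambda>t. cis (2 * pi * t)) \<in>
      uniform_measure lborel {0..1::real} \<rightarrow>\<^sub>M restrict_space borel (sphere 0 1)"
    by (rule measurable_restrict_space2[rotated]) simp
  then show ?thesis
    unfolding circle_measure_def by (rule prob_space.prob_space_distr[OF U])
qed

lemma prob_space_torus: "prob_space (torus N)"
  unfolding torus_def by (rule prob_space_PiM) (rule prob_space_circle_measure)

text \<open>Multi-indices are functions \<open>nat \<Rightarrow> int\<close> of which only the values on \<open>{..<N}\<close> matter.\<close>

definition monomial :: "nat \<Rightarrow> (nat \<Rightarrow> int) \<Rightarrow> (nat \<Rightarrow> complex) \<Rightarrow> complex" where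
  "monomial N \<alpha> \<zeta> = (\<Prod>j<N. \<zeta> j powi \<alpha> j)"

definition fourier_coeff :: "nat \<Rightarrow> ((nat \<Rightarrow> complex) \<Rightarrow> complex) \<Rightarrow> (nat \<Rightarrow> int) \<Rightarrow> complex" where
  "fourier_coeff N f \<alpha> = (LINT \<zeta>|torus N. f \<zeta> * monomial N (\<lambda>j. - \<alpha> j) \<zeta>)"

definition H2 :: "nat \<Rightarrow> ((nat \<Rightarrow> complex) \<Rightarrow> complex) set" where
  "H2 N = {f \<in> L2_space (torus N). \<forall>\<alpha>. \<not> (\<forall>j<N. \<alpha> j \<ge> 0) \<longrightarrow> fourier_coeff N f \<alpha> = 0}"

definition Hinf :: "nat \<Rightarrow> ((nat \<Rightarrow> complex) \<Rightarrow> complex) set" where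
  "Hinf N = {f \<in> H2 N. \<exists>C. AE \<zeta> in torus N. cmod (f \<zeta>) \<le> C}"

definition mult_op ::
  "((nat \<Rightarrow> complex) \<Rightarrow> complex) \<Rightarrow> ((nat \<Rightarrow> complex) \<Rightarrow> complex) \<Rightarrow> (nat \<Rightarrow> complex) \<Rightarrow> complex" where
  "mult_op \<phi> f = (\<lambda>\<zeta>. \<phi> \<zeta> * f \<zeta>)"

definition mult_adj ::
  "nat \<Rightarrow> ((nat \<Rightarrow> complex) \<Rightarrow> complex) \<Rightarrow> ((nat \<Rightarrow> complex) \<Rightarrow> complex)
     \<Rightarrow> (nat \<Rightarrow> complex) \<Rightarrow> complex" where
  "mult_adj N \<phi> = L2_adjoint (torus N) (H2 N) (mult_op \<phi>)"

definition orbit_frame ::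
  "nat \<Rightarrow> ((nat \<Rightarrow> complex) \<Rightarrow> complex) \<Rightarrow> 'i set \<Rightarrow> ('i \<Rightarrow> (nat \<Rightarrow> complex) \<Rightarrow> complex) \<Rightarrow> bool" where
  "orbit_frame N \<phi> I g \<longleftrightarrow> countable I \<and> (\<forall>i\<in>I. g i \<in> H2 N) \<and>
     is_frame (torus N) (H2 N) (I \<times> (UNIV :: nat set)) (\<lambda>(i, n). (mult_adj N \<phi> ^^ n) (g i))"

end

theory Submission
  imports Defs
begin

text \<open>By definition of the adjoint, \<open>\<langle>y, (M\<^sub>\<phi>\<^sup>*)\<^sup>n g\<rangle> = \<langle>\<phi>\<^sup>n y, g\<rangle>\<close> on \<open>H\<^sup>2\<close> (\<open>inner_mult_adj_funpow\<close>), so the frame inequalities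
  compare \<open>\<parallel>y\<parallel>\<^sup>2\<close> with \<open>Q(y) = \<Sum>\<^sub>i \<Sum>\<^sub>n |\<langle>\<phi>\<^sup>n y, g\<^sub>i\<rangle>|\<^sup>2\<close>. Replacing \<open>y\<close> by \<open>\<phi>\<^sup>k y\<close> removes the first \<open>k\<close> terms of
  each inner sum, and all three parts of the theorem exploit this shift.

  A frame forces \<open>|\<phi>| < 1\<close> almost everywhere (\<open>orbit_frame_imp_less_1\<close>): \<open>Q(\<phi>\<^sup>k)\<close> is the tail of
  the convergent series \<open>Q(1)\<close>, so the lower frame bound gives \<open>\<parallel>\<phi>\<^sup>k\<parallel> \<rightarrow> 0\<close>, whereas \<open>\<parallel>\<phi>\<^sup>k\<parallel>\<^sup>2\<close> is at least
  the measure of the set where \<open>|\<phi>| \<ge> 1\<close>.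

  A frame needs infinitely many generators (\<open>orbit_frame_imp_infinite\<close>): the functions
  \<open>e\<^sub>m = \<zeta>\<^sub>1\<^sup>m\<close> are unimodular and tend weakly to zero, even after multiplication by a fixed power of
  \<open>\<phi>\<close>. If \<open>I\<close> is finite, then the terms of \<open>Q(e\<^sub>m)\<close> with \<open>n < K\<close> form a finite sum, which vanishes as
  \<open>m \<rightarrow> \<infinity>\<close>; the remaining terms are \<open>Q(\<phi>\<^sup>K e\<^sub>m) \<le> B \<parallel>\<phi>\<^sup>K e\<^sub>m\<parallel>\<^sup>2 = B \<parallel>\<phi>\<^sup>K\<parallel>\<^sup>2\<close>. Hence \<open>A \<le> B \<parallel>\<phi>\<^sup>K\<parallel>\<^sup>2\<close>
  for every \<open>K\<close>, and the right-hand side tends to zero by the previous paragraph.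

  Conversely, if \<open>|\<phi>| < 1\<close> almost everywhere, put \<open>w = (1 - |\<phi>|\<^sup>2)\<^sup>1\<^sup>/\<^sup>2\<close> and let \<open>g\<^sub>\<alpha>\<close> be the projection to
  \<open>H\<^sup>2\<close> of \<open>w \<zeta>\<^sup>\<alpha>\<close>, for all \<open>\<alpha> \<in> \<int>\<^sup>N\<close>. Parseval's identity gives
  \<open>\<Sum>\<^sub>\<alpha> |\<langle>f, g\<^sub>\<alpha>\<rangle>|\<^sup>2 = \<parallel>w f\<parallel>\<^sup>2 = \<parallel>f\<parallel>\<^sup>2 - \<parallel>\<phi> f\<parallel>\<^sup>2\<close> (\<open>defect_parseval_family\<close>). With \<open>f = \<phi>\<^sup>n y\<close> the sum over
  \<open>n\<close> telescopes to \<open>\<parallel>y\<parallel>\<^sup>2\<close>, because \<open>\<parallel>\<phi>\<^sup>n y\<parallel> \<rightarrow> 0\<close>; the orbit is even a Parseval frame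
  (\<open>less_1_imp_orbit_frame\<close>).

  Most of the text builds the Fourier analysis behind this: completeness of \<open>L\<^sup>2\<close>, uniqueness of
  Fourier coefficients on the torus, Parseval's identity, the projection to \<open>H\<^sup>2\<close> and the adjoint
  of \<open>M\<^sub>\<phi>\<close>.\<close>

section \<open>Square-integrable functions\<close>

abbreviation L2_normsq :: "'a measure \<Rightarrow> ('a \<Rightarrow> complex) \<Rightarrow> real" where
  "L2_normsq M f \<equiv> (LINT x|M. (cmod (f x))\<^sup>2)"

lemma L2_norm_power2: "(L2_norm M f)\<^sup>2 = L2_normsq M f"
  by (simp add: L2_norm_def)

lemma integrable_mult_bounded:
  fixes f g :: "'a \<Rightarrow> complex"
  assumes "integrable M f" "g \<in> borel_measurable M" "AE x in M. cmod (g x) \<le> C"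
  shows "integrable M (\<lambda>x. f x * g x)"
proof (rule Bochner_Integration.integrable_bound)
  show "integrable M (\<lambda>x. complex_of_real C * f x)" using assms(1) by simp
  show "(\<lambda>x. f x * g x) \<in> borel_measurable M"
    using assms(1,2) by (auto intro!: borel_measurable_times)
  show "AE x in M. norm (f x * g x) \<le> norm (complex_of_real C * f x)"
    using assms(3)
  proof eventually_elim
    case (elim x)
    then have "cmod (g x) \<le> \<bar>C\<bar>" by linarith
    then show ?case by (simp add: norm_mult mult.commute[of "cmod (f x)"] mult_right_mono)
  qed
qed

lemma L2_measurable[measurable_dest]: "f \<in> L2_space M \<Longrightarrow> f \<in> borel_measurable M"
  by (simp add: L2_space_def)

lemma L2_integrable_square: "f \<in> L2_space M \<Longrightarrow> integrable M (\<lambda>x. (cmod (f x))\<^sup>2)"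
  by (simp add: L2_space_def)

lemma L2_mult_integrable:
  assumes "f \<in> L2_space M" "g \<in> L2_space M"
  shows "integrable M (\<lambda>x. f x * g x)"
proof (rule Bochner_Integration.integrable_bound)
  show "integrable M (\<lambda>x. (cmod (f x))\<^sup>2 + (cmod (g x))\<^sup>2)"
    by (intro Bochner_Integration.integrable_add L2_integrable_square assms)
  show "(\<lambda>x. f x * g x) \<in> borel_measurable M"
    using assms by (auto simp: L2_space_def)
  have "cmod (f x) * cmod (g x) \<le> (cmod (f x))\<^sup>2 + (cmod (g x))\<^sup>2" for x
  proof -
    have "0 \<le> cmod (f x) * cmod (g x)" by simp
    then show ?thesis
      using sum_squares_bound[of "cmod (f x)" "cmod (g x)"] by linarith
  qed
  then show "AE x in M. norm (f x * g x) \<le> norm ((cmod (f x))\<^sup>2 + (cmod (g x))\<^sup>2)"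
    by (simp add: norm_mult)
qed

lemma L2_add:
  assumes "f \<in> L2_space M" "g \<in> L2_space M"
  shows "(\<lambda>x. f x + g x) \<in> L2_space M"
  unfolding L2_space_def
proof (intro CollectI conjI)
  show "(\<lambda>x. f x + g x) \<in> borel_measurable M" using assms by (auto simp: L2_space_def)
  show "integrable M (\<lambda>x. (cmod (f x + g x))\<^sup>2)"
  proof (rule Bochner_Integration.integrable_bound)
    show "integrable M (\<lambda>x. 2 * ((cmod (f x))\<^sup>2 + (cmod (g x))\<^sup>2))"
      by (intro Bochner_Integration.integrable_add L2_integrable_square assms integrable_mult_right)
    show "(\<lambda>x. (cmod (f x + g x))\<^sup>2) \<in> borel_measurable M"
      using assms by (auto simp: L2_space_def)
    have "(cmod (f x + g x))\<^sup>2 \<le> 2 * ((cmod (f x))\<^sup>2 + (cmod (g x))\<^sup>2)" for x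
    proof -
      have "(cmod (f x + g x))\<^sup>2 \<le> (cmod (f x) + cmod (g x))\<^sup>2"
        by (intro power_mono norm_triangle_ineq) auto
      also have "\<dots> \<le> 2 * ((cmod (f x))\<^sup>2 + (cmod (g x))\<^sup>2)"
        using sum_squares_bound[of "cmod (f x)" "cmod (g x)"] by (simp add: power2_sum)
      finally show ?thesis .
    qed
    then show "AE x in M. norm ((cmod (f x + g x))\<^sup>2) \<le> norm (2 * ((cmod (f x))\<^sup>2 + (cmod (g x))\<^sup>2))"
      by simp
  qed
qed

lemma L2_mult_bounded:
  assumes f: "f \<in> L2_space M" and g: "g \<in> borel_measurable M" "AE x in M. cmod (g x) \<le> C"
  shows "(\<lambda>x. f x * g x) \<in> L2_space M"
  unfolding L2_space_def
proof (intro CollectI conjI)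
  show "(\<lambda>x. f x * g x) \<in> borel_measurable M" using f g by (auto simp: L2_space_def)
  show "integrable M (\<lambda>x. (cmod (f x * g x))\<^sup>2)"
  proof (rule Bochner_Integration.integrable_bound)
    show "integrable M (\<lambda>x. C\<^sup>2 * (cmod (f x))\<^sup>2)"
      by (intro L2_integrable_square f integrable_mult_right)
    show "(\<lambda>x. (cmod (f x * g x))\<^sup>2) \<in> borel_measurable M"
      using f g by (auto simp: L2_space_def)
    show "AE x in M. norm ((cmod (f x * g x))\<^sup>2) \<le> norm (C\<^sup>2 * (cmod (f x))\<^sup>2)"
      using g(2)
    proof eventually_elim
      case (elim x)
      then have "(cmod (g x))\<^sup>2 \<le> C\<^sup>2" by (intro power_mono) auto
      then show ?case by (simp add: norm_mult power_mult_distrib mult.commute[of "(cmod (f x))\<^sup>2"] mult_right_mono)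
    qed
  qed
qed

lemma L2_scale: "f \<in> L2_space M \<Longrightarrow> (\<lambda>x. c * f x) \<in> L2_space M"
  using L2_mult_bounded[of f M "\<lambda>_. c" "cmod c"] by (simp add: mult.commute)

lemma L2_diff: "f \<in> L2_space M \<Longrightarrow> g \<in> L2_space M \<Longrightarrow> (\<lambda>x. f x - g x) \<in> L2_space M"
  using L2_add[of f M "\<lambda>x. (-1) * g x"] L2_scale[of g M "-1"] by simp

lemma borel_measurable_cnj[measurable]:
  "f \<in> borel_measurable M \<Longrightarrow> (\<lambda>x. cnj (f x)) \<in> borel_measurable M"
  by (rule measurable_compose[OF _ borel_measurable_continuous_onI]) (auto intro: continuous_intros)

lemma L2_cnj: "f \<in> L2_space M \<Longrightarrow> (\<lambda>x. cnj (f x)) \<in> L2_space M"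
  unfolding L2_space_def by (simp add: borel_measurable_cnj)

lemma L2_zero: "(\<lambda>x. 0) \<in> L2_space M"
  by (simp add: L2_space_def)

lemma L2_sum: "(\<And>i. i \<in> F \<Longrightarrow> f i \<in> L2_space M) \<Longrightarrow> (\<lambda>x. \<Sum>i\<in>F. f i x) \<in> L2_space M"
  by (induction F rule: infinite_finite_induct) (auto intro: L2_add L2_zero)

lemma L2_inner_integrable:
  "f \<in> L2_space M \<Longrightarrow> g \<in> L2_space M \<Longrightarrow> integrable M (\<lambda>x. f x * cnj (g x))"
  by (intro L2_mult_integrable L2_cnj)

lemma L2_normsq_add:
  assumes "f \<in> L2_space M" "g \<in> L2_space M"
  shows "L2_normsq M (\<lambda>x. f x + g x) = L2_normsq M f + L2_normsq M g + 2 * Re (L2_inner M f g)"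
proof -
  have *: "(cmod (a + b))\<^sup>2 = (cmod a)\<^sup>2 + (cmod b)\<^sup>2 + 2 * Re (a * cnj b)" for a b
    unfolding cmod_power2 by (simp add: power2_eq_square algebra_simps)
  have i: "integrable M (\<lambda>x. f x * cnj (g x))" using assms by (rule L2_inner_integrable)
  have "L2_normsq M (\<lambda>x. f x + g x) =
    (LINT x|M. ((cmod (f x))\<^sup>2 + (cmod (g x))\<^sup>2) + 2 * Re (f x * cnj (g x)))"
    by (simp only: *)
  also have "\<dots> = L2_normsq M f + L2_normsq M g + 2 * (LINT x|M. Re (f x * cnj (g x)))"
    using assms[THEN L2_integrable_square] integrable_Re[OF i]
    by (subst Bochner_Integration.integral_add; simp del: times_complex.sel)+
  also have "(LINT x|M. Re (f x * cnj (g x))) = Re (L2_inner M f g)"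
    unfolding L2_inner_def using i by (rule integral_Re)
  finally show ?thesis .
qed

lemma nn_integral_eq_L2_normsq:
  assumes "f \<in> L2_space M"
  shows "(\<integral>\<^sup>+x. ennreal ((cmod (f x))\<^sup>2) \<partial>M) = ennreal (L2_normsq M f)"
  by (rule nn_integral_eq_integral[OF L2_integrable_square[OF assms]]) simp

lemma L2_normsq_nonneg: "0 \<le> L2_normsq M f"
  by simp

lemma L2_inner_self:
  assumes "f \<in> L2_space M" shows "L2_inner M f f = of_real (L2_normsq M f)"
  unfolding L2_inner_def complex_norm_square[symmetric] by (rule integral_complex_of_real)

lemma L2_inner_diff_right:
  assumes "f \<in> L2_space M" "g \<in> L2_space M" "h \<in> L2_space M"
  shows "L2_inner M f (\<lambda>x. g x - h x) = L2_inner M f g - L2_inner M f h"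
  unfolding L2_inner_def complex_cnj_diff right_diff_distrib
  by (intro Bochner_Integration.integral_diff L2_inner_integrable assms)

lemma L2_inner_scale_right: "L2_inner M f (\<lambda>x. c * g x) = cnj c * L2_inner M f g"
proof -
  have "L2_inner M f (\<lambda>x. c * g x) = (LINT x|M. cnj c * (f x * cnj (g x)))"
    unfolding L2_inner_def by (intro Bochner_Integration.integral_cong refl) simp
  then show ?thesis by (simp add: L2_inner_def)
qed

lemma L2_inner_sum_right:
  assumes "f \<in> L2_space M" "\<And>i. i \<in> F \<Longrightarrow> g i \<in> L2_space M"
  shows "L2_inner M f (\<lambda>x. \<Sum>i\<in>F. g i x) = (\<Sum>i\<in>F. L2_inner M f (g i))"
  unfolding L2_inner_def cnj_sum sum_distrib_left
  by (intro Bochner_Integration.integral_sum L2_inner_integrable assms)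

lemma L2_normsq_diff:
  assumes "f \<in> L2_space M" "g \<in> L2_space M"
  shows "L2_normsq M (\<lambda>x. f x - g x) = L2_normsq M f + L2_normsq M g - 2 * Re (L2_inner M f g)"
  using L2_normsq_add[OF assms(1) L2_scale[OF assms(2), of "-1"]] L2_inner_scale_right[of M f "-1" g]
  by simp

lemma L2_normsq_cong_AE:
  assumes "f \<in> L2_space M" "g \<in> L2_space M" "AE x in M. f x = g x"
  shows "L2_normsq M f = L2_normsq M g"
proof (rule integral_cong_AE)
  show "AE x in M. (cmod (f x))\<^sup>2 = (cmod (g x))\<^sup>2" using assms(3) by eventually_elim simp
qed (use assms L2_measurable in auto)

section \<open>Completeness\<close>

text \<open>Along a subsequence whose consecutive distances decay like \<open>2^-k\<close> the increments are
  absolutely summable almost everywhere, so it converges pointwise; Fatou's lemma shows that the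
  pointwise limit is the limit in norm.\<close>

lemma (in prob_space) L2_complete:
  assumes f: "\<And>n. f n \<in> L2_space M"
    and cauchy: "\<And>e. e > 0 \<Longrightarrow> \<exists>K. \<forall>m\<ge>K. \<forall>n\<ge>K. L2_normsq M (\<lambda>x. f m x - f n x) < e"
  shows "\<exists>g\<in>L2_space M. (\<lambda>n. L2_normsq M (\<lambda>x. g x - f n x)) \<longlonglongrightarrow> 0"
proof -
  have meas[measurable]: "f n \<in> borel_measurable M" for n using f by (rule L2_measurable)
  have "\<forall>k. \<exists>K. \<forall>m\<ge>K. \<forall>n\<ge>K. L2_normsq M (\<lambda>x. f m x - f n x) < (1/4)^k"
    by (intro allI cauchy) simp
  then obtain K where K: "\<And>k m n. m \<ge> K k \<Longrightarrow> n \<ge> K k \<Longrightarrow> L2_normsq M (\<lambda>x. f m x - f n x) < (1/4)^k"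
    by (auto dest!: choice)
  \<comment> \<open>partial sums make \<open>r\<close> increasing while keeping \<open>r k \<ge> K k\<close>; the summand \<open>k\<close> makes it unbounded\<close>
  define r where "r k = (\<Sum>i\<le>k. K i) + k" for k
  have rK: "r k \<ge> K k" for k
    unfolding r_def by (induction k) auto
  have "r k \<le> r (Suc k)" for k unfolding r_def by simp
  have rge: "r k \<ge> k" for k by (simp add: r_def)
  define D where "D k x = cmod (f (r (Suc k)) x - f (r k) x)" for k x
  have Dmeas[measurable]: "D k \<in> borel_measurable M" for k unfolding D_def by measurable
  have "AE x in M. summable (\<lambda>k. D k x)"
  proof -
    have le: "(\<integral>\<^sup>+x. ennreal (D k x) \<partial>M) \<le> ennreal ((1/2)^k)" for k
    proof -
      have L: "(\<lambda>x. f (r (Suc k)) x - f (r k) x) \<in> L2_space M" by (intro L2_diff f)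
      have "(\<integral>\<^sup>+x. ennreal (D k x) \<partial>M)
          \<le> (\<integral>\<^sup>+x. ennreal (2^k / 2 * (D k x)\<^sup>2 + (1/2)^k / 2) \<partial>M)"
      proof (intro nn_integral_mono ennreal_leI)
        fix x
        \<comment> \<open>the weighted arithmetic--geometric mean inequality bounds the \<open>L\<^sup>1\<close> norm by the \<open>L\<^sup>2\<close> norm\<close>
        have "0 \<le> (2^k * D k x - 1)\<^sup>2" by simp
        then have "2 * 2^k * D k x \<le> 2^k * 2^k * (D k x)\<^sup>2 + 1"
          by (simp add: power2_diff power_mult_distrib power2_eq_square algebra_simps)
        then show "D k x \<le> 2^k / 2 * (D k x)\<^sup>2 + (1/2)^k / 2"
          by (simp add: field_simps power_one_over)
      qed
      also have "\<dots> = ennreal (2^k / 2 * L2_normsq M (\<lambda>x. f (r (Suc k)) x - f (r k) x) + (1/2)^k / 2)"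
        using L2_integrable_square[OF L] unfolding D_def
        by (subst nn_integral_eq_integral) (auto simp: prob_space)
      also have "\<dots> \<le> ennreal ((1/2)^k)"
      proof (rule ennreal_leI)
        have "L2_normsq M (\<lambda>x. f (r (Suc k)) x - f (r k) x) < (1/4)^k"
          using K[of k "r (Suc k)" "r k"] rK[of k] \<open>r k \<le> r (Suc k)\<close> by linarith
        then have "2^k / 2 * L2_normsq M (\<lambda>x. f (r (Suc k)) x - f (r k) x) \<le> 2^k/2 * (1/4)^k"
          by (intro mult_left_mono) auto
        also have "\<dots> = (2 * (1/4))^k / 2" by (simp only: power_mult_distrib times_divide_eq_left)
        also have "\<dots> = (1/2)^k / (2::real)" by simp
        finally show "2^k / 2 * L2_normsq M (\<lambda>x. f (r (Suc k)) x - f (r k) x) + (1/2)^k / 2 \<le> (1/2)^k"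
          by simp
      qed
      finally show ?thesis .
    qed
    have "(\<integral>\<^sup>+x. (\<Sum>k. ennreal (D k x)) \<partial>M) = (\<Sum>k. \<integral>\<^sup>+x. ennreal (D k x) \<partial>M)"
      by (rule nn_integral_suminf) simp
    also have "\<dots> \<le> (\<Sum>k. ennreal ((1/2)^k))"
      by (intro suminf_le le) auto
    also have "\<dots> < \<infinity>"
      using geometric_sums[of "1/2::real"]
      by (subst suminf_ennreal_eq[where x = 2]) auto
    finally have "(\<integral>\<^sup>+x. (\<Sum>k. ennreal (D k x)) \<partial>M) \<noteq> \<infinity>" by simp
    then have "AE x in M. (\<Sum>k. ennreal (D k x)) \<noteq> \<infinity>"
      by (intro nn_integral_PInf_AE) auto
    then show ?thesis
    proof eventually_elim
      case (elim x)
      then show ?case by (intro summable_suminf_not_top) (auto simp: D_def)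
    qed
  qed
  define g where "g x = lim (\<lambda>k. f (r k) x)" for x
  have gm[measurable]: "g \<in> borel_measurable M"
    unfolding g_def by measurable
  have lim: "AE x in M. (\<lambda>k. f (r k) x) \<longlonglongrightarrow> g x"
    using \<open>AE x in M. summable (\<lambda>k. D k x)\<close>
  proof eventually_elim
    case (elim x)
    then have "summable (\<lambda>k. f (r (Suc k)) x - f (r k) x)"
      unfolding D_def by (rule summable_norm_cancel)
    then have "convergent (\<lambda>n. \<Sum>k<n. f (r (Suc k)) x - f (r k) x)"
      by (simp add: summable_iff_convergent)
    then have "convergent (\<lambda>n. f (r n) x - f (r 0) x)"
      using sum_lessThan_telescope[of "\<lambda>n. f (r n) x"] by simp
    then have "convergent (\<lambda>n. f (r n) x)"
      using convergent_add_const_iff[of "- f (r 0) x" "\<lambda>n. f (r n) x"] by simp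
    then show ?case unfolding g_def by (simp add: convergent_LIMSEQ_iff)
  qed
  \<comment> \<open>Fatou's lemma along the subsequence, with the index \<open>n\<close> held fixed\<close>
  have fatou: "(\<integral>\<^sup>+x. ennreal ((cmod (g x - f n x))\<^sup>2) \<partial>M) \<le> ennreal e"
    if "\<And>m. m \<ge> L \<Longrightarrow> L2_normsq M (\<lambda>x. f m x - f n x) < e" for n L e
  proof -
    have "(\<integral>\<^sup>+x. ennreal ((cmod (g x - f n x))\<^sup>2) \<partial>M)
        = (\<integral>\<^sup>+x. liminf (\<lambda>k. ennreal ((cmod (f (r k) x - f n x))\<^sup>2)) \<partial>M)"
    proof (rule nn_integral_cong_AE, use lim in eventually_elim)
      case (elim x)
      have "(\<lambda>k. ennreal ((cmod (f (r k) x - f n x))\<^sup>2)) \<longlonglongrightarrow> ennreal ((cmod (g x - f n x))\<^sup>2)"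
        by (intro tendsto_intros elim tendsto_ennrealI)
      then show ?case by (rule lim_imp_Liminf[OF sequentially_bot, symmetric])
    qed
    also have "\<dots> \<le> liminf (\<lambda>k. \<integral>\<^sup>+x. ennreal ((cmod (f (r k) x - f n x))\<^sup>2) \<partial>M)"
      by (rule nn_integral_liminf) measurable
    also have "\<dots> \<le> liminf (\<lambda>k. ennreal e)"
    proof (rule Liminf_mono, rule eventually_sequentiallyI[of L])
      fix k assume "L \<le> k"
      then have "L2_normsq M (\<lambda>x. f (r k) x - f n x) < e"
        using rge[of k] by (intro that) linarith
      then show "(\<integral>\<^sup>+x. ennreal ((cmod (f (r k) x - f n x))\<^sup>2) \<partial>M) \<le> ennreal e"
        using nn_integral_eq_L2_normsq[OF L2_diff[OF f[of "r k"] f[of n]]] by (simp add: ennreal_leI)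
    qed
    also have "\<dots> = ennreal e" by (simp add: Liminf_const)
    finally show ?thesis .
  qed
  have gL: "(\<lambda>x. g x - f n x) \<in> L2_space M" if "n \<ge> K 0" for n
  proof -
    have "(\<integral>\<^sup>+x. ennreal ((cmod (g x - f n x))\<^sup>2) \<partial>M) \<le> ennreal 1"
      using K[of 0] that by (intro fatou[of "K 0"]) auto
    then have "(\<integral>\<^sup>+x. ennreal ((cmod (g x - f n x))\<^sup>2) \<partial>M) < \<infinity>"
      by (rule le_less_trans) simp
    then have "integrable M (\<lambda>x. (cmod (g x - f n x))\<^sup>2)"
      by (intro integrableI_nonneg) auto
    then show ?thesis by (simp add: L2_space_def)
  qed
  have "g \<in> L2_space M"
    using L2_add[OF gL[of "K 0"] f[of "K 0"]] by simp
  moreover have "(\<lambda>n. L2_normsq M (\<lambda>x. g x - f n x)) \<longlonglongrightarrow> 0"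
  proof (rule LIMSEQ_I)
    fix e :: real assume "e > 0"
    then obtain L where L: "\<And>m n. m \<ge> L \<Longrightarrow> n \<ge> L \<Longrightarrow> L2_normsq M (\<lambda>x. f m x - f n x) < e/2"
      using cauchy[of "e/2"] by auto
    show "\<exists>no. \<forall>n\<ge>no. norm (L2_normsq M (\<lambda>x. g x - f n x) - 0) < e"
    proof (intro exI[of _ "max L (K 0)"] allI impI)
      fix n assume "n \<ge> max L (K 0)"
      then have "ennreal (L2_normsq M (\<lambda>x. g x - f n x)) \<le> ennreal (e/2)"
        using fatou[of L n "e/2"] L nn_integral_eq_L2_normsq[OF gL[of n]] by simp
      then show "norm (L2_normsq M (\<lambda>x. g x - f n x) - 0) < e"
        using \<open>e > 0\<close> by (simp add: ennreal_le_iff)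
    qed
  qed
  ultimately show ?thesis by blast
qed

section \<open>Monomials on the torus\<close>

interpretation circle: prob_space circle_measure
  by (rule prob_space_circle_measure)

interpretation torus: prob_space "torus N" for N
  by (rule prob_space_torus)

lemma space_circle_measure: "space circle_measure = {z. cmod z = 1}"
  by (simp add: circle_measure_def space_restrict_space sphere_def)

lemma sets_circle_measure: "sets circle_measure = sets (restrict_space borel (sphere 0 1))"
  by (simp add: circle_measure_def)

lemma measurable_circle_borel: "(\<lambda>z. z) \<in> borel_measurable circle_measure"
  unfolding measurable_cong_sets[OF sets_circle_measure refl]
  by (rule measurable_restrict_space1) simp

lemma borel_measurable_powi[measurable]:
  fixes f :: "'a \<Rightarrow> complex"
  assumes [measurable]: "f \<in> borel_measurable M"
  shows "(\<lambda>x. f x powi k) \<in> borel_measurable M"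
  unfolding power_int_def by (cases "k \<ge> 0") simp_all

lemma torus_coordinate_measurable[measurable]:
  assumes "j < N" shows "(\<lambda>\<zeta>. \<zeta> j) \<in> borel_measurable (torus N)"
proof -
  have "(\<lambda>\<zeta>. \<zeta> j) \<in> torus N \<rightarrow>\<^sub>M circle_measure"
    unfolding torus_def by (rule measurable_component_singleton) (use assms in auto)
  from measurable_compose[OF this measurable_circle_borel] show ?thesis .
qed

lemma cmod_torus: "\<zeta> \<in> space (torus N) \<Longrightarrow> j < N \<Longrightarrow> cmod (\<zeta> j) = 1"
  by (auto simp: space_torus PiE_def Pi_def)

lemma torus_nonzero: "\<zeta> \<in> space (torus N) \<Longrightarrow> j < N \<Longrightarrow> \<zeta> j \<noteq> 0"
  using cmod_torus[of \<zeta> N j] by auto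

lemma monomial_measurable[measurable]: "monomial N \<alpha> \<in> borel_measurable (torus N)"
  unfolding monomial_def by (intro borel_measurable_prod borel_measurable_powi) auto

lemma cmod_monomial: "\<zeta> \<in> space (torus N) \<Longrightarrow> cmod (monomial N \<alpha> \<zeta>) = 1"
  unfolding monomial_def prod_norm[symmetric] by (intro prod.neutral) (auto simp: norm_power_int cmod_torus)

lemma AE_cmod_monomial: "AE \<zeta> in torus N. cmod (monomial N \<alpha> \<zeta>) \<le> 1"
  by (rule AE_I2) (simp add: cmod_monomial)

lemma monomial_0[simp]: "monomial N (\<lambda>_. 0) \<zeta> = 1"
  by (simp add: monomial_def)

lemma monomial_add:
  "\<zeta> \<in> space (torus N) \<Longrightarrow> monomial N \<alpha> \<zeta> * monomial N \<beta> \<zeta> = monomial N (\<lambda>j. \<alpha> j + \<beta> j) \<zeta>"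
  unfolding monomial_def prod.distrib[symmetric]
  by (intro prod.cong refl) (simp add: power_int_add torus_nonzero)

lemma monomial_uminus:
  assumes "\<zeta> \<in> space (torus N)"
  shows "monomial N (\<lambda>j. - \<alpha> j) \<zeta> = cnj (monomial N \<alpha> \<zeta>)"
proof -
  have "monomial N \<alpha> \<zeta> * monomial N (\<lambda>j. - \<alpha> j) \<zeta> = 1"
    using assms by (simp add: monomial_add)
  moreover have "monomial N \<alpha> \<zeta> * cnj (monomial N \<alpha> \<zeta>) = 1"
    using cmod_monomial[OF assms] by (simp add: complex_norm_square[symmetric])
  ultimately show ?thesis
    by (metis mult_cancel_left mult_zero_left zero_neq_one)
qed

lemma monomial_L2: "monomial N \<alpha> \<in> L2_space (torus N)"
proof -
  have "(\<lambda>_. 1) \<in> L2_space (torus N)" by (simp add: L2_space_def)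
  from L2_mult_bounded[OF this monomial_measurable AE_cmod_monomial] show ?thesis by simp
qed

text \<open>This orthogonality relation on one circle is the only place where the measure is computed; on the
  torus it is inherited factor by factor.\<close>

lemma integral_circle_powi:
  "(LINT z|circle_measure. z powi k) = (if k = 0 then 1 else 0)"
proof (cases "k = 0")
  case True
  then show ?thesis by (simp add: circle.prob_space)
next
  case False
  define c where "c = 2 * pi * real_of_int k"
  have c0: "c \<noteq> 0" using False by (simp add: c_def)
  have m1: "(\<lambda>t. cis (2 * pi * t)) \<in> borel_measurable borel"
    by (intro borel_measurable_continuous_onI continuous_intros)
  have m2: "(\<lambda>t. cis (2 * pi * t)) \<in>
      uniform_measure lborel {0..1::real} \<rightarrow>\<^sub>M restrict_space borel (sphere 0 1)"
    by (rule measurable_restrict_space2) (use m1 in auto)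
  have m3: "(\<lambda>z::complex. z powi k) \<in> borel_measurable (restrict_space borel (sphere 0 1))"
    by (rule measurable_restrict_space1) measurable
  have m4: "(\<lambda>t. cis (2 * pi * t) powi k) \<in> borel_measurable lborel"
    using m1 by measurable
  have "(LINT z|circle_measure. z powi k)
      = (LINT t|uniform_measure lborel {0..1::real}. cis (2 * pi * t) powi k)"
    unfolding circle_measure_def by (rule integral_distr[OF m2 m3])
  also have "\<dots> = (LINT t|density lborel (indicator {0..1::real}). cis (2 * pi * t) powi k)"
    unfolding uniform_measure_def by (simp add: divide_ennreal_def)
  also have "\<dots> = (LINT t|density lborel (\<lambda>t. ennreal (indicator {0..1::real} t)). cis (2 * pi * t) powi k)"
    by (simp add: ennreal_indicator)
  also have "\<dots> = (LINT t|lborel. indicator {0..1::real} t *\<^sub>R (cis (2 * pi * t) powi k))"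
    by (subst integral_density) (use m4 in auto)
  also have "\<dots> = (LINT t|lborel. indicator {0..1::real} t *\<^sub>R cis (c * t))"
    by (intro Bochner_Integration.integral_cong refl) (simp add: cis_power_int c_def mult_ac)
  also have "\<dots> = cis (c * 1) / (\<i> * of_real c) - cis (c * 0) / (\<i> * of_real c)"
  proof (rule integral_FTC_Icc)
    show "((\<lambda>t. cis (c * t) / (\<i> * of_real c)) has_vector_derivative cis (c * t)) (at t within {0..1})"
      if "0 \<le> t" "t \<le> 1" for t
    proof -
      have "((\<lambda>z. exp (\<i> * of_real c * z) / (\<i> * of_real c)) has_field_derivative
          exp (\<i> * of_real c * of_real t)) (at (of_real t))"
        using c0 by (auto intro!: derivative_eq_intros)
      from has_vector_derivative_real_field[OF this]
      show ?thesis by (simp add: cis_conv_exp mult.assoc)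
    qed
    show "continuous_on {0..1} (\<lambda>t. cis (c * t))" by (intro continuous_intros)
  qed simp
  also have "\<dots> = 0"
    unfolding c_def by (simp add: cis_multiple_2pi)
  finally show ?thesis using False by simp
qed

lemma integral_monomial:
  "(LINT \<zeta>|torus N. monomial N \<alpha> \<zeta>) = (if \<forall>j<N. \<alpha> j = 0 then 1 else 0)"
proof -
  interpret P: product_sigma_finite "\<lambda>_::nat. circle_measure"
    by unfold_locales
  have "(LINT \<zeta>|torus N. monomial N \<alpha> \<zeta>) = (\<Prod>j<N. LINT z|circle_measure. z powi \<alpha> j)"
    unfolding monomial_def torus_def
  proof (rule P.product_integral_prod)
    fix j assume "j \<in> {..<N}"
    show "integrable circle_measure (\<lambda>z. z powi \<alpha> j)"
      by (rule circle.integrable_const_bound[where B = 1])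
         (auto simp: space_circle_measure norm_power_int intro!: AE_I2 borel_measurable_powi measurable_circle_borel)
  qed simp
  also have "\<dots> = (if \<forall>j<N. \<alpha> j = 0 then 1 else 0)"
    by (auto simp: integral_circle_powi)
  finally show ?thesis .
qed

lemma fourier_coeff_eq_inner: "fourier_coeff N f \<alpha> = L2_inner (torus N) f (monomial N \<alpha>)"
  unfolding fourier_coeff_def L2_inner_def
  by (intro Bochner_Integration.integral_cong refl) (simp add: monomial_uminus)

lemma fourier_coeff_cong: "(\<And>j. j < N \<Longrightarrow> \<alpha> j = \<beta> j) \<Longrightarrow> fourier_coeff N f \<alpha> = fourier_coeff N f \<beta>"
  unfolding fourier_coeff_def monomial_def by simp

lemma integrable_mult_monomial:
  "integrable (torus N) f \<Longrightarrow> integrable (torus N) (\<lambda>\<zeta>. f \<zeta> * monomial N \<alpha> \<zeta>)"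
  by (rule integrable_mult_bounded[OF _ monomial_measurable AE_cmod_monomial])

lemma L2_integrable: "f \<in> L2_space (torus N) \<Longrightarrow> integrable (torus N) f"
  using L2_mult_integrable[of f "torus N" "monomial N (\<lambda>_. 0)"] monomial_L2[of N "\<lambda>_. 0"]
  by simp

lemma fourier_coeff_add:
  "integrable (torus N) f \<Longrightarrow> integrable (torus N) g \<Longrightarrow>
    fourier_coeff N (\<lambda>\<zeta>. f \<zeta> + g \<zeta>) \<alpha> = fourier_coeff N f \<alpha> + fourier_coeff N g \<alpha>"
  unfolding fourier_coeff_def distrib_right
  by (intro Bochner_Integration.integral_add integrable_mult_monomial)

lemma fourier_coeff_scale:
  "fourier_coeff N (\<lambda>\<zeta>. c * f \<zeta>) \<alpha> = c * fourier_coeff N f \<alpha>"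
  unfolding fourier_coeff_def mult.assoc by simp

lemma fourier_coeff_diff:
  "integrable (torus N) f \<Longrightarrow> integrable (torus N) g \<Longrightarrow>
    fourier_coeff N (\<lambda>\<zeta>. f \<zeta> - g \<zeta>) \<alpha> = fourier_coeff N f \<alpha> - fourier_coeff N g \<alpha>"
  unfolding fourier_coeff_def left_diff_distrib
  by (intro Bochner_Integration.integral_diff integrable_mult_monomial)

lemma fourier_coeff_sum:
  "(\<And>i. i \<in> F \<Longrightarrow> integrable (torus N) (f i)) \<Longrightarrow>
    fourier_coeff N (\<lambda>\<zeta>. \<Sum>i\<in>F. f i \<zeta>) \<alpha> = (\<Sum>i\<in>F. fourier_coeff N (f i) \<alpha>)"
  unfolding fourier_coeff_def sum_distrib_right
  by (intro Bochner_Integration.integral_sum integrable_mult_monomial)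

lemma fourier_coeff_monomial_mult:
  "fourier_coeff N (\<lambda>\<zeta>. f \<zeta> * monomial N \<beta> \<zeta>) \<alpha> = fourier_coeff N f (\<lambda>j. \<alpha> j - \<beta> j)"
  unfolding fourier_coeff_def
  by (intro Bochner_Integration.integral_cong refl) (simp add: mult.assoc monomial_add)

lemma fourier_coeff_monomial:
  "fourier_coeff N (monomial N \<beta>) \<alpha> = (if \<forall>j<N. \<alpha> j = \<beta> j then 1 else 0)"
proof -
  have "fourier_coeff N (monomial N \<beta>) \<alpha> = (LINT \<zeta>|torus N. monomial N (\<lambda>j. \<beta> j - \<alpha> j) \<zeta>)"
    unfolding fourier_coeff_def
    by (intro Bochner_Integration.integral_cong refl) (simp add: monomial_add)
  then show ?thesis by (auto simp: integral_monomial)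
qed

section \<open>Functions are determined by their Fourier coefficients\<close>

text \<open>The class of functions to be shown to vanish. Stating closure properties of the class, instead of
  identities for single integrals, makes it possible to multiply by one factor after another.\<close>

definition null_spectrum :: "nat \<Rightarrow> ((nat \<Rightarrow> complex) \<Rightarrow> complex) \<Rightarrow> bool" where
  "null_spectrum N G \<longleftrightarrow> integrable (torus N) G \<and> (\<forall>\<alpha>. fourier_coeff N G \<alpha> = 0)"

lemma null_spectrum_add:
  "null_spectrum N G \<Longrightarrow> null_spectrum N H \<Longrightarrow> null_spectrum N (\<lambda>\<zeta>. G \<zeta> + H \<zeta>)"
  by (simp add: null_spectrum_def fourier_coeff_add)

lemma null_spectrum_diff:
  "null_spectrum N G \<Longrightarrow> null_spectrum N H \<Longrightarrow> null_spectrum N (\<lambda>\<zeta>. G \<zeta> - H \<zeta>)"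
  by (simp add: null_spectrum_def fourier_coeff_diff)

lemma null_spectrum_scale:
  "null_spectrum N G \<Longrightarrow> null_spectrum N (\<lambda>\<zeta>. c * G \<zeta>)"
  by (simp add: null_spectrum_def fourier_coeff_scale)

lemma null_spectrum_cong:
  assumes "null_spectrum N G" "\<And>\<zeta>. \<zeta> \<in> space (torus N) \<Longrightarrow> G \<zeta> = H \<zeta>"
  shows "null_spectrum N H"
proof -
  have "integrable (torus N) G = integrable (torus N) H"
    by (intro Bochner_Integration.integrable_cong refl assms(2))
  moreover have "fourier_coeff N G \<alpha> = fourier_coeff N H \<alpha>" for \<alpha>
    unfolding fourier_coeff_def by (intro Bochner_Integration.integral_cong refl) (simp add: assms(2))
  ultimately show ?thesis using assms(1) by (simp add: null_spectrum_def)
qed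

lemma monomial_single:
  assumes "j < N"
  shows "monomial N (\<lambda>i. if i = j then k else 0) \<zeta> = \<zeta> j powi k"
proof -
  have "monomial N (\<lambda>i. if i = j then k else 0) \<zeta> = (\<Prod>i<N. if i = j then \<zeta> j powi k else 1)"
    unfolding monomial_def by (intro prod.cong) auto
  then show ?thesis using assms by simp
qed

lemma null_spectrum_coordinate:
  assumes "null_spectrum N G" "j < N"
  shows "null_spectrum N (\<lambda>\<zeta>. G \<zeta> * \<zeta> j powi k)"
  using assms(1) integrable_mult_monomial[of N G "\<lambda>i. if i = j then k else 0"]
    fourier_coeff_monomial_mult[of N G "\<lambda>i. if i = j then k else 0"]
  unfolding null_spectrum_def monomial_single[OF assms(2)] by simp

text \<open>Dominated convergence: the multipliers that preserve a vanishing spectrum are closed under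
  bounded pointwise limits.\<close>

lemma null_spectrum_limit:
  assumes G: "\<And>n. null_spectrum N (\<lambda>\<zeta>. G \<zeta> * u n \<zeta>)" "integrable (torus N) G"
    and u: "\<And>n. u n \<in> borel_measurable (torus N)"
      "\<And>n \<zeta>. \<zeta> \<in> space (torus N) \<Longrightarrow> cmod (u n \<zeta>) \<le> C"
      "\<And>\<zeta>. \<zeta> \<in> space (torus N) \<Longrightarrow> (\<lambda>n. u n \<zeta>) \<longlonglongrightarrow> v \<zeta>"
  shows "null_spectrum N (\<lambda>\<zeta>. G \<zeta> * v \<zeta>)"
  unfolding null_spectrum_def
proof (intro conjI allI)
  have v[measurable]: "v \<in> borel_measurable (torus N)"
    using u(3,1) by (rule borel_measurable_LIMSEQ_metric[rotated])
  have vC: "cmod (v \<zeta>) \<le> C" if "\<zeta> \<in> space (torus N)" for \<zeta>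
    by (rule LIMSEQ_le_const2[OF tendsto_norm[OF u(3)[OF that]]]) (use u(2) that in auto)
  show "integrable (torus N) (\<lambda>\<zeta>. G \<zeta> * v \<zeta>)"
    by (rule integrable_mult_bounded[OF G(2) v, of C]) (use vC in auto)
  fix \<alpha>
  have Gm[measurable]: "G \<in> borel_measurable (torus N)" using G(2) by simp
  note u(1)[measurable]
  have "(\<lambda>n. LINT \<zeta>|torus N. G \<zeta> * u n \<zeta> * monomial N (\<lambda>j. - \<alpha> j) \<zeta>)
      \<longlonglongrightarrow> (LINT \<zeta>|torus N. G \<zeta> * v \<zeta> * monomial N (\<lambda>j. - \<alpha> j) \<zeta>)"
  proof (rule integral_dominated_convergence[where w = "\<lambda>\<zeta>. C * cmod (G \<zeta>)"])
    show "integrable (torus N) (\<lambda>\<zeta>. C * cmod (G \<zeta>))" using G(2) by simp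
    show "AE \<zeta> in torus N. (\<lambda>n. G \<zeta> * u n \<zeta> * monomial N (\<lambda>j. - \<alpha> j) \<zeta>)
        \<longlonglongrightarrow> G \<zeta> * v \<zeta> * monomial N (\<lambda>j. - \<alpha> j) \<zeta>"
      by (rule AE_I2) (intro tendsto_intros u(3))
    show "AE \<zeta> in torus N. norm (G \<zeta> * u n \<zeta> * monomial N (\<lambda>j. - \<alpha> j) \<zeta>) \<le> C * cmod (G \<zeta>)" for n
    proof (rule AE_I2)
      fix \<zeta> assume "\<zeta> \<in> space (torus N)"
      with u(2)[OF this, of n] show "norm (G \<zeta> * u n \<zeta> * monomial N (\<lambda>j. - \<alpha> j) \<zeta>) \<le> C * cmod (G \<zeta>)"
        by (simp add: norm_mult cmod_monomial mult.commute[of "cmod (G \<zeta>)"] mult_right_mono)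
    qed
  qed measurable
  moreover have "(LINT \<zeta>|torus N. G \<zeta> * u n \<zeta> * monomial N (\<lambda>j. - \<alpha> j) \<zeta>) = 0" for n
    using G(1)[of n] by (simp add: null_spectrum_def fourier_coeff_def)
  ultimately have "(\<lambda>n. 0) \<longlonglongrightarrow> (LINT \<zeta>|torus N. G \<zeta> * v \<zeta> * monomial N (\<lambda>j. - \<alpha> j) \<zeta>)"
    by simp
  then show "fourier_coeff N (\<lambda>\<zeta>. G \<zeta> * v \<zeta>) \<alpha> = 0"
    unfolding fourier_coeff_def by (simp add: LIMSEQ_const_iff)
qed

text \<open>On the circle the real and imaginary part of \<open>z\<close> are combinations of \<open>z\<close> and \<open>z\<^sup>-\<^sup>1\<close>, and multiplying
  by these only shifts the spectrum. The statement is general in \<open>G\<close> so that a product of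
  polynomials can be treated by applying the induction hypothesis twice.\<close>

lemma null_spectrum_polynomial:
  assumes "real_polynomial_function p" "j < N" "null_spectrum N G"
  shows "null_spectrum N (\<lambda>\<zeta>. G \<zeta> * complex_of_real (p (\<zeta> j)))"
  using assms(1,3)
proof (induction p arbitrary: G)
  case (linear f)
  have f: "f z = Re z * f 1 + Im z * f \<i>" for z
  proof -
    have "f z = f (Re z *\<^sub>R 1 + Im z *\<^sub>R \<i>)"
      by (rule arg_cong[of _ _ f]) (simp add: complex_eq_iff)
    also have "\<dots> = Re z * f 1 + Im z * f \<i>"
      using linear(1) by (simp add: bounded_linear.linear linear_add linear_scale)
    finally show ?thesis .
  qed
  have inv: "\<zeta> j powi (-1) = cnj (\<zeta> j)" if "\<zeta> \<in> space (torus N)" for \<zeta>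
  proof -
    have "\<zeta> j * cnj (\<zeta> j) = 1"
      using cmod_torus[OF that assms(2)] by (simp add: complex_norm_square[symmetric])
    then show ?thesis using inverse_unique[of "\<zeta> j"] by (simp add: power_int_minus)
  qed
  show ?case
  proof (rule null_spectrum_cong)
    show "null_spectrum N (\<lambda>\<zeta>. ((f 1 - \<i> * f \<i>) / 2) * (G \<zeta> * \<zeta> j powi 1)
        + ((f 1 + \<i> * f \<i>) / 2) * (G \<zeta> * \<zeta> j powi (-1)))"
      by (intro null_spectrum_add null_spectrum_scale null_spectrum_coordinate linear assms(2))
    fix \<zeta> assume "\<zeta> \<in> space (torus N)"
    note inv = inv[OF this]
    show "((f 1 - \<i> * f \<i>) / 2) * (G \<zeta> * \<zeta> j powi 1)
        + ((f 1 + \<i> * f \<i>) / 2) * (G \<zeta> * \<zeta> j powi (-1)) = G \<zeta> * complex_of_real (f (\<zeta> j))"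
      unfolding inv f[of "\<zeta> j"] by (simp add: complex_eq_iff field_simps)
  qed
next
  case (const c)
  then show ?case using null_spectrum_scale[of N G "complex_of_real c"] by (simp add: mult.commute)
next
  case (add f g)
  then show ?case
    using null_spectrum_add[OF add.IH(1)[OF add.prems] add.IH(2)[OF add.prems]]
    by (simp add: distrib_left)
next
  case (mult f g)
  then show ?case
    using mult.IH(2)[OF mult.IH(1)[OF mult.prems]] by (simp add: mult.assoc)
qed

text \<open>The indicator of a closed set is a bounded pointwise limit of continuous functions, and these are
  uniform limits of polynomials by the Stone--Weierstrass theorem.\<close>

lemma null_spectrum_closed:
  assumes A: "closed A" and j: "j < N" and G: "null_spectrum N G"
  shows "null_spectrum N (\<lambda>\<zeta>. G \<zeta> * indicator A (\<zeta> j))"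
proof (cases "A = {}")
  case True
  then show ?thesis using null_spectrum_scale[OF G, of 0] by simp
next
  case False
  \<comment> \<open>continuous functions that equal \<open>1\<close> on \<open>A\<close> and decrease to its indicator\<close>
  define h where "h m z = max 0 (1 - real m * infdist z A)" for m and z :: complex
  have "\<exists>p. real_polynomial_function p \<and> (\<forall>z\<in>sphere 0 1. \<bar>h m z - p z\<bar> < 1 / real (Suc m))" for m
  proof -
    have "continuous_on (sphere 0 1) (h m)"
      unfolding h_def by (intro continuous_intros)
    then show ?thesis
      using Stone_Weierstrass_real_polynomial_function[of "sphere (0::complex) 1" "h m" "1 / real (Suc m)"]
      by (metis compact_sphere of_nat_0_less_iff zero_less_Suc zero_less_divide_1_iff)
  qed
  then obtain p where p: "\<And>m. real_polynomial_function (p m)"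
    "\<And>m z. cmod z = 1 \<Longrightarrow> \<bar>h m z - p m z\<bar> < 1 / real (Suc m)"
    by (metis mem_sphere_0)
  have hlim: "(\<lambda>m. h m z) \<longlonglongrightarrow> indicator A z" for z
  proof (cases "z \<in> A")
    case True
    then show ?thesis by (simp add: h_def)
  next
    case zA: False
    then have "infdist z A > 0"
      using A False by (metis in_closed_iff_infdist_zero infdist_nonneg order_le_less)
    then obtain M where M: "1 < real M * infdist z A"
      using reals_Archimedean3 by blast
    have "eventually (\<lambda>m. h m z = 0) sequentially"
    proof (rule eventually_sequentiallyI[of M])
      fix m assume "M \<le> m"
      then have "real M * infdist z A \<le> real m * infdist z A"
        by (intro mult_right_mono) (auto simp: infdist_nonneg)
      then show "h m z = 0" using M by (simp add: h_def)
    qed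
    then show ?thesis using zA by (simp add: tendsto_eventually)
  qed
  have plim: "(\<lambda>m. p m z) \<longlonglongrightarrow> indicator A z" if "cmod z = 1" for z
  proof -
    have "(\<lambda>m. h m z - p m z) \<longlonglongrightarrow> 0"
      by (rule Lim_null_comparison[OF _ LIMSEQ_inverse_real_of_nat])
         (use p(2)[OF that] in \<open>auto intro!: always_eventually less_imp_le simp: inverse_eq_divide\<close>)
    from tendsto_diff[OF hlim[of z] this] show ?thesis by simp
  qed
  \<comment> \<open>\<open>0 \<le> h m \<le> 1\<close> and the approximation error is at most \<open>1\<close>\<close>
  have pb: "\<bar>p m z\<bar> \<le> 2" if "cmod z = 1" for m z
  proof -
    have "0 \<le> real m * infdist z A" by (simp add: infdist_nonneg)
    then have "0 \<le> h m z" "h m z \<le> 1" by (auto simp: h_def)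
    moreover have "1 / real (Suc m) \<le> 1" by simp
    ultimately show ?thesis using p(2)[OF that, of m] by linarith
  qed
  show ?thesis
  proof (rule null_spectrum_limit[where u = "\<lambda>m \<zeta>. complex_of_real (p m (\<zeta> j))" and C = 2])
    show "null_spectrum N (\<lambda>\<zeta>. G \<zeta> * complex_of_real (p m (\<zeta> j)))" for m
      by (rule null_spectrum_polynomial[OF p(1) j G])
    show "integrable (torus N) G" using G by (simp add: null_spectrum_def)
    show "(\<lambda>\<zeta>. complex_of_real (p m (\<zeta> j))) \<in> borel_measurable (torus N)" for m
    proof -
      have "continuous_on UNIV (p m)"
        by (intro continuous_at_imp_continuous_on ballI continuous_real_polymonial_function p(1))
      then have "p m \<in> borel_measurable borel" by (rule borel_measurable_continuous_onI)
      from measurable_compose[OF torus_coordinate_measurable[OF j] this] show ?thesis by simp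
    qed
    fix \<zeta> assume "\<zeta> \<in> space (torus N)"
    then have *: "cmod (\<zeta> j) = 1" by (rule cmod_torus[OF _ j])
    show "cmod (complex_of_real (p m (\<zeta> j))) \<le> 2" for m using pb[OF *] by simp
    show "(\<lambda>m. complex_of_real (p m (\<zeta> j))) \<longlonglongrightarrow> indicator A (\<zeta> j)"
      using tendsto_of_real[OF plim[OF *], where 'a = complex] by (cases "\<zeta> j \<in> A") simp_all
  qed
qed

text \<open>The sets whose indicators preserve a vanishing spectrum form a \<open>\<sigma>\<close>-algebra: intersections are
  handled by multiplying twice, countable unions by bounded limits. It contains the preimages of
  closed sets under every coordinate, and hence all measurable sets.\<close>

lemma null_spectrum_indicator:
  assumes A: "A \<in> sets (torus N)" and G: "null_spectrum N G"
  shows "null_spectrum N (\<lambda>\<zeta>. G \<zeta> * indicator A \<zeta>)"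
proof -
  define \<C> where "\<C> = {A \<in> sets (torus N). \<forall>G. null_spectrum N G \<longrightarrow> null_spectrum N (\<lambda>\<zeta>. G \<zeta> * indicator A \<zeta>)}"
  have empty: "{} \<in> \<C>"
    unfolding \<C>_def using null_spectrum_scale[of N _ 0] by auto
  have Un: "A \<union> B \<in> \<C>" if "A \<in> \<C>" "B \<in> \<C>" for A B
    unfolding \<C>_def
  proof (intro CollectI conjI allI impI)
    fix G assume "null_spectrum N G"
    then have "null_spectrum N (\<lambda>\<zeta>. (G \<zeta> * indicator A \<zeta> + G \<zeta> * indicator B \<zeta>) - G \<zeta> * indicator A \<zeta> * indicator B \<zeta>)"
      using that by (intro null_spectrum_add null_spectrum_diff) (auto simp: \<C>_def)
    then show "null_spectrum N (\<lambda>\<zeta>. G \<zeta> * indicator (A \<union> B) \<zeta>)"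
      by (rule null_spectrum_cong) (auto simp: indicator_def)
  qed (use that in \<open>auto simp: \<C>_def\<close>)
  have "sigma_algebra (space (torus N)) \<C>"
    unfolding sigma_algebra_iff2
  proof (intro conjI ballI allI impI)
    show "\<C> \<subseteq> Pow (space (torus N))"
      using sets.sets_into_space by (auto simp: \<C>_def)
    show "{} \<in> \<C>" by (rule empty)
    fix s assume s: "s \<in> \<C>"
    show "space (torus N) - s \<in> \<C>"
      unfolding \<C>_def
    proof (intro CollectI conjI allI impI)
      fix G assume "null_spectrum N G"
      then have "null_spectrum N (\<lambda>\<zeta>. G \<zeta> - G \<zeta> * indicator s \<zeta>)"
        using s by (intro null_spectrum_diff) (auto simp: \<C>_def)
      then show "null_spectrum N (\<lambda>\<zeta>. G \<zeta> * indicator (space (torus N) - s) \<zeta>)"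
        by (rule null_spectrum_cong) (auto simp: indicator_def)
    qed (use s in \<open>auto simp: \<C>_def\<close>)
  next
    fix A :: "nat \<Rightarrow> (nat \<Rightarrow> complex) set" assume A: "range A \<subseteq> \<C>"
    have fin: "(\<Union>i<n. A i) \<in> \<C>" for n
    proof (induction n)
      case (Suc n)
      have "(\<Union>i<Suc n. A i) = (\<Union>i<n. A i) \<union> A n" by (auto simp: less_Suc_eq)
      then show ?case using Suc Un[of "\<Union>i<n. A i" "A n"] A by (simp add: range_subsetD)
    qed (simp add: empty)
    show "(\<Union>i. A i) \<in> \<C>"
      unfolding \<C>_def
    proof (intro CollectI conjI allI impI)
      show "(\<Union>i. A i) \<in> sets (torus N)" using A by (auto simp: \<C>_def)
      fix G assume G: "null_spectrum N G"
      show "null_spectrum N (\<lambda>\<zeta>. G \<zeta> * indicator (\<Union>i. A i) \<zeta>)"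
      proof (rule null_spectrum_limit[where u = "\<lambda>n. indicator (\<Union>i<n. A i)" and C = 1])
        show "null_spectrum N (\<lambda>\<zeta>. G \<zeta> * indicator (\<Union>i<n. A i) \<zeta>)" for n
          using fin[of n] G by (simp add: \<C>_def)
        show "integrable (torus N) G" using G by (simp add: null_spectrum_def)
        show "indicator (\<Union>i<n. A i) \<in> borel_measurable (torus N)" for n
          using fin[of n] by (intro borel_measurable_indicator) (simp add: \<C>_def)
        show "cmod (indicator (\<Union>i<n. A i) \<zeta>) \<le> 1" for n \<zeta> by (simp add: indicator_def)
        show "(\<lambda>n. indicator (\<Union>i<n. A i) \<zeta> :: complex) \<longlonglongrightarrow> indicator (\<Union>i. A i) \<zeta>" for \<zeta>
          by (rule LIMSEQ_indicator_UN)
      qed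
    qed
  qed
  then interpret C: sigma_algebra "space (torus N)" \<C> .
  have setsC: "sets (sigma (space (torus N)) \<C>) = \<C>" by (rule C.sets_measure_of_eq)
  have spC: "space (sigma (space (torus N)) \<C>) = space (torus N)" by (simp add: C.space_closed)
  have coord: "(\<lambda>\<zeta>. \<zeta> j) \<in> borel_measurable (sigma (space (torus N)) \<C>)" if j: "j < N" for j
    unfolding borel_eq_closed
  proof (rule measurable_measure_of)
    fix B :: "complex set" assume "B \<in> Collect closed"
    then have B: "closed B" by simp
    have "(\<lambda>\<zeta>. \<zeta> j) -` B \<inter> space (torus N) \<in> \<C>"
      unfolding \<C>_def
    proof (intro CollectI conjI allI impI)
      show "(\<lambda>\<zeta>. \<zeta> j) -` B \<inter> space (torus N) \<in> sets (torus N)"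
        using torus_coordinate_measurable[OF j] B by (intro measurable_sets) auto
      fix G assume G: "null_spectrum N G"
      show "null_spectrum N (\<lambda>\<zeta>. G \<zeta> * indicator ((\<lambda>\<zeta>. \<zeta> j) -` B \<inter> space (torus N)) \<zeta>)"
        by (rule null_spectrum_cong[OF null_spectrum_closed[OF B j G]]) (auto simp: indicator_def)
    qed
    then show "(\<lambda>\<zeta>. \<zeta> j) -` B \<inter> space (sigma (space (torus N)) \<C>) \<in> sets (sigma (space (torus N)) \<C>)"
      by (simp add: setsC spC)
  qed auto
  have "sets (torus N) \<subseteq> sets (sigma (space (torus N)) \<C>)"
    unfolding torus_def
  proof (rule sets_PiM_in_sets, unfold torus_def[symmetric])
    show "space (sigma (space (torus N)) \<C>) = (\<Pi>\<^sub>E i\<in>{..<N}. space circle_measure)"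
      unfolding spC by (simp add: torus_def space_PiM)
    fix j A assume j: "j \<in> {..<N}" and "A \<in> sets circle_measure"
    then obtain B where B: "B \<in> sets borel" "A = sphere 0 1 \<inter> B"
      unfolding sets_circle_measure by (auto simp: sets_restrict_space)
    have "{\<zeta> \<in> space (sigma (space (torus N)) \<C>). \<zeta> j \<in> A}
        = (\<lambda>\<zeta>. \<zeta> j) -` B \<inter> space (sigma (space (torus N)) \<C>)"
      unfolding spC using j by (auto simp: B(2) cmod_torus)
    also have "\<dots> \<in> sets (sigma (space (torus N)) \<C>)"
      using coord[of j] B(1) j by (intro measurable_sets) auto
    finally show "{\<zeta> \<in> space (sigma (space (torus N)) \<C>). \<zeta> j \<in> A} \<in> sets (sigma (space (torus N)) \<C>)" .
  qed
  then have "A \<in> \<C>" using A setsC by auto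
  then show ?thesis using G by (simp add: \<C>_def)
qed

lemma AE_eq_0_if_set_integrals_0:
  fixes h :: "'a \<Rightarrow> real"
  assumes h: "integrable M h" and 0: "\<And>A. A \<in> sets M \<Longrightarrow> (LINT x|M. h x * indicator A x) = 0"
  shows "AE x in M. h x = 0"
proof -
  have [measurable]: "h \<in> borel_measurable M" using h by simp
  have *: "AE x in M. \<bar>h x\<bar> * indicator A x = 0" if A: "A \<in> sets M" and s: "\<And>x. x \<in> A \<Longrightarrow> \<bar>h x\<bar> = s * h x" for A s
  proof -
    have eq: "\<bar>h x\<bar> * indicator A x = s * (h x * indicator A x)" for x
      using s by (auto simp: indicator_def)
    have "integrable M (\<lambda>x. \<bar>h x\<bar> * indicator A x)"
      using integrable_mult_indicator[OF A integrable_abs[OF h]] by (simp add: mult.commute)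
    moreover have "(LINT x|M. \<bar>h x\<bar> * indicator A x) = 0"
      unfolding eq using 0[OF A] by simp
    ultimately show ?thesis
      by (subst (asm) integral_nonneg_eq_0_iff_AE) auto
  qed
  have "AE x in M. \<bar>h x\<bar> * indicator {x \<in> space M. h x > 0} x = 0"
    by (rule *[of _ 1]) auto
  moreover have "AE x in M. \<bar>h x\<bar> * indicator {x \<in> space M. h x < 0} x = 0"
    by (rule *[of _ "-1"]) auto
  ultimately show ?thesis
    using AE_space by eventually_elim (auto simp: indicator_def split: if_splits)
qed

text \<open>The mean of \<open>G\<close> times an indicator is a Fourier coefficient at zero, so \<open>G\<close> integrates to zero
  over every measurable set.\<close>

theorem fourier_uniqueness:
  assumes "integrable (torus N) G" "\<And>\<alpha>. fourier_coeff N G \<alpha> = 0"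
  shows "AE \<zeta> in torus N. G \<zeta> = 0"
proof -
  have G: "null_spectrum N G" using assms by (simp add: null_spectrum_def)
  have 0: "(LINT \<zeta>|torus N. G \<zeta> * indicator A \<zeta>) = 0" and i: "integrable (torus N) (\<lambda>\<zeta>. G \<zeta> * indicator A \<zeta>)"
    if "A \<in> sets (torus N)" for A
  proof -
    have *: "null_spectrum N (\<lambda>\<zeta>. G \<zeta> * indicator A \<zeta>)" by (rule null_spectrum_indicator[OF that G])
    then have "fourier_coeff N (\<lambda>\<zeta>. G \<zeta> * indicator A \<zeta>) (\<lambda>_. 0) = 0" by (simp add: null_spectrum_def)
    then show "(LINT \<zeta>|torus N. G \<zeta> * indicator A \<zeta>) = 0" by (simp add: fourier_coeff_def)
    show "integrable (torus N) (\<lambda>\<zeta>. G \<zeta> * indicator A \<zeta>)" using * by (simp add: null_spectrum_def)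
  qed
  have "AE \<zeta> in torus N. Re (G \<zeta>) = 0"
  proof (rule AE_eq_0_if_set_integrals_0)
    fix A assume A: "A \<in> sets (torus N)"
    have "(LINT \<zeta>|torus N. Re (G \<zeta>) * indicator A \<zeta>) = (LINT \<zeta>|torus N. Re (G \<zeta> * indicator A \<zeta>))"
      by (intro Bochner_Integration.integral_cong refl) (simp add: indicator_def)
    then show "(LINT \<zeta>|torus N. Re (G \<zeta>) * indicator A \<zeta>) = 0"
      using integral_Re[OF i[OF A]] 0[OF A] by simp
  qed (use assms(1) in simp)
  moreover have "AE \<zeta> in torus N. Im (G \<zeta>) = 0"
  proof (rule AE_eq_0_if_set_integrals_0)
    fix A assume A: "A \<in> sets (torus N)"
    have "(LINT \<zeta>|torus N. Im (G \<zeta>) * indicator A \<zeta>) = (LINT \<zeta>|torus N. Im (G \<zeta> * indicator A \<zeta>))"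
      by (intro Bochner_Integration.integral_cong refl) (simp add: indicator_def)
    then show "(LINT \<zeta>|torus N. Im (G \<zeta>) * indicator A \<zeta>) = 0"
      using integral_Im[OF i[OF A]] 0[OF A] by simp
  qed (use assms(1) in simp)
  ultimately show ?thesis by eventually_elim (simp add: complex_eq_iff)
qed

section \<open>Parseval's identity and the Riesz--Fischer theorem\<close>

text \<open>Extensional functions represent each element of \<open>\<int>\<^sup>N\<close> once. This makes the index set countable and
  distinct indices give distinct monomials.\<close>

definition multi_indices :: "nat \<Rightarrow> (nat \<Rightarrow> int) set" where
  "multi_indices N = {..<N} \<rightarrow>\<^sub>E UNIV"

lemma countable_multi_indices: "countable (multi_indices N)"
  unfolding multi_indices_def by (rule countable_PiE) auto

lemma multi_indices_eq_iff:
  "\<alpha> \<in> multi_indices N \<Longrightarrow> \<beta> \<in> multi_indices N \<Longrightarrow> (\<forall>j<N. \<alpha> j = \<beta> j) \<longleftrightarrow> \<alpha> = \<beta>"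
  unfolding multi_indices_def by (auto intro: PiE_ext)

lemma fourier_coeff_restrict:
  "fourier_coeff N f (restrict \<alpha> {..<N}) = fourier_coeff N f \<alpha>"
  by (rule fourier_coeff_cong) simp

lemma restrict_in_multi_indices: "restrict \<alpha> {..<N} \<in> multi_indices N"
  by (simp add: multi_indices_def)

definition trig_poly :: "nat \<Rightarrow> (nat \<Rightarrow> int) set \<Rightarrow> ((nat \<Rightarrow> int) \<Rightarrow> complex) \<Rightarrow> (nat \<Rightarrow> complex) \<Rightarrow> complex" where
  "trig_poly N F c \<zeta> = (\<Sum>\<alpha>\<in>F. c \<alpha> * monomial N \<alpha> \<zeta>)"

lemma trig_poly_L2: "trig_poly N F c \<in> L2_space (torus N)"
proof -
  have "(\<lambda>\<zeta>. \<Sum>\<alpha>\<in>F. c \<alpha> * monomial N \<alpha> \<zeta>) \<in> L2_space (torus N)"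
    by (intro L2_sum L2_scale monomial_L2)
  then show ?thesis by (simp add: trig_poly_def[abs_def])
qed

lemma fourier_coeff_trig_poly:
  assumes "finite F" "F \<subseteq> multi_indices N" "\<beta> \<in> multi_indices N"
  shows "fourier_coeff N (trig_poly N F c) \<beta> = (if \<beta> \<in> F then c \<beta> else 0)"
proof -
  have "fourier_coeff N (trig_poly N F c) \<beta> = (\<Sum>\<alpha>\<in>F. c \<alpha> * fourier_coeff N (monomial N \<alpha>) \<beta>)"
    unfolding trig_poly_def[abs_def]
    by (subst fourier_coeff_sum) (auto simp: fourier_coeff_scale intro!: L2_integrable L2_scale monomial_L2)
  also have "\<dots> = (\<Sum>\<alpha>\<in>F. if \<alpha> = \<beta> then c \<alpha> else 0)"
  proof (rule sum.cong)
    fix \<alpha> assume "\<alpha> \<in> F"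
    then have "(\<forall>j<N. \<beta> j = \<alpha> j) \<longleftrightarrow> \<alpha> = \<beta>"
      using multi_indices_eq_iff[of \<beta> N \<alpha>] assms by auto
    then show "c \<alpha> * fourier_coeff N (monomial N \<alpha>) \<beta> = (if \<alpha> = \<beta> then c \<alpha> else 0)"
      by (simp add: fourier_coeff_monomial)
  qed simp
  also have "\<dots> = (if \<beta> \<in> F then c \<beta> else 0)" using assms(1) by simp
  finally show ?thesis .
qed

lemma L2_inner_trig_poly:
  assumes "f \<in> L2_space (torus N)"
  shows "L2_inner (torus N) f (trig_poly N F c) = (\<Sum>\<alpha>\<in>F. cnj (c \<alpha>) * fourier_coeff N f \<alpha>)"
  unfolding trig_poly_def[abs_def]
  by (subst L2_inner_sum_right)
     (auto simp: L2_inner_scale_right fourier_coeff_eq_inner assms intro!: L2_scale monomial_L2)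

lemma L2_normsq_trig_poly:
  assumes "finite F" "F \<subseteq> multi_indices N"
  shows "L2_normsq (torus N) (trig_poly N F c) = (\<Sum>\<alpha>\<in>F. (cmod (c \<alpha>))\<^sup>2)"
proof -
  have "complex_of_real (L2_normsq (torus N) (trig_poly N F c))
      = (\<Sum>\<alpha>\<in>F. cnj (c \<alpha>) * fourier_coeff N (trig_poly N F c) \<alpha>)"
    using L2_inner_trig_poly[OF trig_poly_L2] L2_inner_self[OF trig_poly_L2] by metis
  also have "\<dots> = (\<Sum>\<alpha>\<in>F. complex_of_real ((cmod (c \<alpha>))\<^sup>2))"
  proof (intro sum.cong refl)
    fix \<alpha> assume "\<alpha> \<in> F"
    then show "cnj (c \<alpha>) * fourier_coeff N (trig_poly N F c) \<alpha> = complex_of_real ((cmod (c \<alpha>))\<^sup>2)"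
      using assms fourier_coeff_trig_poly[OF assms, of \<alpha> c]
      by (simp add: subsetD complex_norm_square mult.commute del: of_real_power)
  qed
  also have "\<dots> = complex_of_real (\<Sum>\<alpha>\<in>F. (cmod (c \<alpha>))\<^sup>2)" by simp
  finally show ?thesis by (simp only: of_real_eq_iff)
qed

lemma L2_normsq_diff_trig_poly:
  assumes "finite F" "F \<subseteq> multi_indices N" "u \<in> L2_space (torus N)"
  shows "L2_normsq (torus N) (\<lambda>\<zeta>. u \<zeta> - trig_poly N F (fourier_coeff N u) \<zeta>)
    = L2_normsq (torus N) u - (\<Sum>\<alpha>\<in>F. (cmod (fourier_coeff N u \<alpha>))\<^sup>2)"
proof -
  have "L2_inner (torus N) u (trig_poly N F (fourier_coeff N u))
      = complex_of_real (\<Sum>\<alpha>\<in>F. (cmod (fourier_coeff N u \<alpha>))\<^sup>2)"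
    unfolding L2_inner_trig_poly[OF assms(3)] of_real_sum
    by (intro sum.cong refl) (simp add: complex_norm_square mult.commute del: of_real_power)
  then show ?thesis
    by (simp add: L2_normsq_diff[OF assms(3) trig_poly_L2] L2_normsq_trig_poly[OF assms(1,2)])
qed

lemma bessel_inequality:
  assumes "finite F" "F \<subseteq> multi_indices N" "u \<in> L2_space (torus N)"
  shows "(\<Sum>\<alpha>\<in>F. (cmod (fourier_coeff N u \<alpha>))\<^sup>2) \<le> L2_normsq (torus N) u"
  using L2_normsq_diff_trig_poly[OF assms]
    L2_normsq_nonneg[of "torus N" "\<lambda>\<zeta>. u \<zeta> - trig_poly N F (fourier_coeff N u) \<zeta>"]
  by linarith

lemma fourier_coeff_bound:
  assumes "u \<in> L2_space (torus N)"
  shows "(cmod (fourier_coeff N u \<alpha>))\<^sup>2 \<le> L2_normsq (torus N) u"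
  using bessel_inequality[of "{restrict \<alpha> {..<N}}" N u] assms
  by (simp add: restrict_in_multi_indices fourier_coeff_restrict)

text \<open>The partial sums of the Fourier series over \<open>Y\<close> are Cauchy by Bessel's inequality. For the set of
  all indices the limit \<open>p\<close> is \<open>u\<close> itself and the lemma yields Parseval's identity; for the
  nonnegative indices \<open>p\<close> is the projection of \<open>u\<close> to \<open>H\<^sup>2\<close>.\<close>

lemma riesz_fischer_projection:
  assumes u: "u \<in> L2_space (torus N)" and Y: "Y \<subseteq> multi_indices N"
  obtains p F where "p \<in> L2_space (torus N)"
    "\<And>\<alpha>. \<alpha> \<in> multi_indices N \<Longrightarrow> fourier_coeff N p \<alpha> = (if \<alpha> \<in> Y then fourier_coeff N u \<alpha> else 0)"
    "\<And>n::nat. finite (F n)" "\<And>n. F n \<subseteq> Y"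
    "(\<lambda>n. L2_normsq (torus N) (\<lambda>\<zeta>. p \<zeta> - trig_poly N (F n) (fourier_coeff N u) \<zeta>)) \<longlonglongrightarrow> 0"
proof -
  let ?c = "fourier_coeff N u"
  define enum where "enum = to_nat_on (multi_indices N)"
  have inj: "inj_on enum (multi_indices N)"
    unfolding enum_def by (rule inj_on_to_nat_on[OF countable_multi_indices])
  \<comment> \<open>finite sets exhausting \<open>Y\<close>, along an enumeration of all multi-indices\<close>
  define F where "F n = {\<alpha>\<in>Y. enum \<alpha> < n}" for n
  have FY: "F n \<subseteq> Y" for n by (auto simp: F_def)
  have Ffin: "finite (F n)" for n
  proof (rule finite_imageD)
    show "finite (enum ` F n)" by (rule finite_subset[of _ "{..<n}"]) (auto simp: F_def)
    show "inj_on enum (F n)" using inj by (rule inj_on_subset) (use Y FY in blast)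
  qed
  have Fmono: "F n \<subseteq> F m" if "n \<le> m" for n m using that by (auto simp: F_def)
  define s where "s n = (\<Sum>\<alpha>\<in>F n. (cmod (?c \<alpha>))\<^sup>2)" for n
  have "convergent s"
  proof (rule Bseq_mono_convergent)
    have "\<bar>s n\<bar> \<le> L2_normsq (torus N) u" for n
      using bessel_inequality[OF Ffin subset_trans[OF FY Y] u, of n] by (simp add: s_def sum_nonneg)
    then show "Bseq s" by (intro BseqI') auto
    show "\<forall>m n. m \<le> n \<longrightarrow> s m \<le> s n"
      unfolding s_def by (intro allI impI sum_mono2 Ffin Fmono) auto
  qed
  then have Cs: "Cauchy s" by (rule convergent_Cauchy)
  define S where "S n = trig_poly N (F n) ?c" for n
  have SS: "L2_normsq (torus N) (\<lambda>\<zeta>. S m \<zeta> - S n \<zeta>) = s m - s n" if "n \<le> m" for n m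
  proof -
    have eq: "S m \<zeta> - S n \<zeta> = trig_poly N (F m - F n) ?c \<zeta>" for \<zeta>
      unfolding S_def trig_poly_def by (simp add: sum_diff[OF Ffin Fmono[OF that]])
    have "F m - F n \<subseteq> multi_indices N" using FY Y by blast
    then show ?thesis
      unfolding eq by (simp add: L2_normsq_trig_poly Ffin s_def sum_diff[OF Ffin Fmono[OF that]])
  qed
  have SS': "L2_normsq (torus N) (\<lambda>\<zeta>. S m \<zeta> - S n \<zeta>) = \<bar>s m - s n\<bar>" for n m
  proof (cases "n \<le> m")
    case True
    then show ?thesis using SS[OF True] L2_normsq_nonneg[of "torus N" "\<lambda>\<zeta>. S m \<zeta> - S n \<zeta>"] by linarith
  next
    case False
    then have "n \<ge> m" by simp
    have "L2_normsq (torus N) (\<lambda>\<zeta>. S m \<zeta> - S n \<zeta>) = L2_normsq (torus N) (\<lambda>\<zeta>. S n \<zeta> - S m \<zeta>)"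
      by (simp add: norm_minus_commute)
    then show ?thesis
      using SS[OF \<open>n \<ge> m\<close>] L2_normsq_nonneg[of "torus N" "\<lambda>\<zeta>. S n \<zeta> - S m \<zeta>"] by linarith
  qed
  have SL: "S n \<in> L2_space (torus N)" for n unfolding S_def by (rule trig_poly_L2)
  have "\<exists>p\<in>L2_space (torus N). (\<lambda>n. L2_normsq (torus N) (\<lambda>\<zeta>. p \<zeta> - S n \<zeta>)) \<longlonglongrightarrow> 0"
  proof (rule torus.L2_complete[OF SL])
    fix e :: real assume "e > 0"
    then show "\<exists>K. \<forall>m\<ge>K. \<forall>n\<ge>K. L2_normsq (torus N) (\<lambda>\<zeta>. S m \<zeta> - S n \<zeta>) < e"
      unfolding SS' using Cs by (auto simp: Cauchy_def dist_real_def)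
  qed
  then obtain p where p: "p \<in> L2_space (torus N)"
    "(\<lambda>n. L2_normsq (torus N) (\<lambda>\<zeta>. p \<zeta> - S n \<zeta>)) \<longlonglongrightarrow> 0" by blast
  have "fourier_coeff N p \<alpha> = (if \<alpha> \<in> Y then ?c \<alpha> else 0)" if \<alpha>: "\<alpha> \<in> multi_indices N" for \<alpha>
  proof -
    have ev: "eventually (\<lambda>n. fourier_coeff N (S n) \<alpha> = (if \<alpha> \<in> Y then ?c \<alpha> else 0)) sequentially"
    proof (rule eventually_sequentiallyI[of "Suc (enum \<alpha>)"])
      fix n assume n: "Suc (enum \<alpha>) \<le> n"
      have "fourier_coeff N (S n) \<alpha> = (if \<alpha> \<in> F n then ?c \<alpha> else 0)"
        unfolding S_def by (rule fourier_coeff_trig_poly[OF Ffin _ \<alpha>]) (use FY Y in blast)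
      then show "fourier_coeff N (S n) \<alpha> = (if \<alpha> \<in> Y then ?c \<alpha> else 0)"
        using n by (auto simp: F_def)
    qed
    have "(\<lambda>n. (cmod (fourier_coeff N p \<alpha> - fourier_coeff N (S n) \<alpha>))\<^sup>2) \<longlonglongrightarrow> 0"
    proof (rule Lim_null_comparison[OF always_eventually p(2)], rule allI)
      fix n
      show "norm ((cmod (fourier_coeff N p \<alpha> - fourier_coeff N (S n) \<alpha>))\<^sup>2)
          \<le> L2_normsq (torus N) (\<lambda>\<zeta>. p \<zeta> - S n \<zeta>)"
        using fourier_coeff_bound[OF L2_diff[OF p(1) SL[of n]]]
        by (simp add: fourier_coeff_diff L2_integrable p(1) SL)
    qed
    then have "(\<lambda>n. sqrt ((cmod (fourier_coeff N p \<alpha> - fourier_coeff N (S n) \<alpha>))\<^sup>2)) \<longlonglongrightarrow> sqrt 0"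
      by (rule tendsto_real_sqrt)
    then have "(\<lambda>n. fourier_coeff N p \<alpha> - fourier_coeff N (S n) \<alpha>) \<longlonglongrightarrow> 0"
      by (simp add: tendsto_norm_zero_iff)
    then have "(\<lambda>n. fourier_coeff N p \<alpha> - (if \<alpha> \<in> Y then ?c \<alpha> else 0)) \<longlonglongrightarrow> 0"
      by (rule Lim_transform_eventually) (use ev in eventually_elim, simp)
    then show ?thesis by (simp add: LIMSEQ_const_iff)
  qed
  from that[OF p(1) this Ffin FY p(2)[unfolded S_def]] show thesis by simp
qed

text \<open>The sum of the Fourier series of \<open>u\<close> has the same coefficients as \<open>u\<close>, hence equals \<open>u\<close> almost
  everywhere, and the defect in Bessel's inequality tends to zero.\<close>

theorem parseval:
  assumes u: "u \<in> L2_space (torus N)"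
  shows "((\<lambda>\<alpha>. (cmod (fourier_coeff N u \<alpha>))\<^sup>2) has_sum L2_normsq (torus N) u) (multi_indices N)"
proof -
  let ?a = "\<lambda>\<alpha>. (cmod (fourier_coeff N u \<alpha>))\<^sup>2"
  obtain p F where p: "p \<in> L2_space (torus N)"
    "\<And>\<alpha>. \<alpha> \<in> multi_indices N \<Longrightarrow> fourier_coeff N p \<alpha> = fourier_coeff N u \<alpha>"
    and F: "\<And>n::nat. finite (F n)" "\<And>n. F n \<subseteq> multi_indices N"
    "(\<lambda>n. L2_normsq (torus N) (\<lambda>\<zeta>. p \<zeta> - trig_poly N (F n) (fourier_coeff N u) \<zeta>)) \<longlonglongrightarrow> 0"
    by (rule riesz_fischer_projection[OF u subset_refl]) auto
  have "AE \<zeta> in torus N. p \<zeta> - u \<zeta> = 0"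
  proof (rule fourier_uniqueness)
    show "integrable (torus N) (\<lambda>\<zeta>. p \<zeta> - u \<zeta>)" using p(1) u by (intro L2_integrable L2_diff)
    fix \<alpha>
    have "fourier_coeff N p \<alpha> = fourier_coeff N u \<alpha>"
      using p(2)[OF restrict_in_multi_indices, of \<alpha>] by (simp add: fourier_coeff_restrict)
    then show "fourier_coeff N (\<lambda>\<zeta>. p \<zeta> - u \<zeta>) \<alpha> = 0"
      using p(1) u by (simp add: fourier_coeff_diff L2_integrable)
  qed
  then have ae: "AE \<zeta> in torus N. p \<zeta> = u \<zeta>" by simp
  have "L2_normsq (torus N) (\<lambda>\<zeta>. p \<zeta> - trig_poly N (F n) (fourier_coeff N u) \<zeta>)
      = L2_normsq (torus N) u - sum ?a (F n)" for n
  proof -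
    have "L2_normsq (torus N) (\<lambda>\<zeta>. p \<zeta> - trig_poly N (F n) (fourier_coeff N u) \<zeta>)
        = L2_normsq (torus N) (\<lambda>\<zeta>. u \<zeta> - trig_poly N (F n) (fourier_coeff N u) \<zeta>)"
      by (rule L2_normsq_cong_AE) (use ae in \<open>auto intro!: L2_diff trig_poly_L2 p(1) u elim: eventually_mono\<close>)
    then show ?thesis by (simp add: L2_normsq_diff_trig_poly[OF F(1,2) u])
  qed
  with F(3) have "(\<lambda>n. L2_normsq (torus N) u - sum ?a (F n)) \<longlonglongrightarrow> 0" by simp
  from tendsto_diff[OF tendsto_const[of "L2_normsq (torus N) u"] this]
  have lim: "(\<lambda>n. sum ?a (F n)) \<longlonglongrightarrow> L2_normsq (torus N) u" by simp
  have summ: "?a summable_on multi_indices N"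
    by (rule nonneg_bdd_above_summable_on)
       (auto intro!: bdd_aboveI[of _ "L2_normsq (torus N) u"] bessel_inequality u)
  have "infsum ?a (multi_indices N) \<le> L2_normsq (torus N) u"
    by (rule infsum_le_finite_sums[OF summ]) (rule bessel_inequality[OF _ _ u])
  moreover have "L2_normsq (torus N) u \<le> infsum ?a (multi_indices N)"
    by (rule LIMSEQ_le_const2[OF lim])
       (auto intro!: exI[of _ 0] finite_sum_le_infsum summ F(1,2))
  ultimately have "infsum ?a (multi_indices N) = L2_normsq (torus N) u" by simp
  then show ?thesis using has_sum_infsum[OF summ] by simp
qed

text \<open>Disjoint spectra make Parseval's identity additive, so \<open>\<parallel>f + c h\<parallel>\<^sup>2 = \<parallel>f\<parallel>\<^sup>2 + \<parallel>c h\<parallel>\<^sup>2\<close>; the cases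
  \<open>c = 1\<close> and \<open>c = \<i>\<close> show that the real and the imaginary part of the inner product vanish.\<close>

lemma L2_inner_eq_0_if_disjoint_spectra:
  assumes f: "f \<in> L2_space (torus N)" and h: "h \<in> L2_space (torus N)"
    and disj: "\<And>\<alpha>. fourier_coeff N f \<alpha> = 0 \<or> fourier_coeff N h \<alpha> = 0"
  shows "L2_inner (torus N) f h = 0"
proof -
  have *: "Re (L2_inner (torus N) f (\<lambda>\<zeta>. c * h \<zeta>)) = 0" for c
  proof -
    let ?h = "\<lambda>\<zeta>. c * h \<zeta>"
    have ch: "?h \<in> L2_space (torus N)" by (rule L2_scale[OF h])
    have "((\<lambda>\<alpha>. (cmod (fourier_coeff N f \<alpha>))\<^sup>2 + (cmod (fourier_coeff N ?h \<alpha>))\<^sup>2) has_sum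
        (L2_normsq (torus N) f + L2_normsq (torus N) ?h)) (multi_indices N)"
      by (intro has_sum_add parseval f ch)
    moreover have "(cmod (fourier_coeff N f \<alpha>))\<^sup>2 + (cmod (fourier_coeff N ?h \<alpha>))\<^sup>2
        = (cmod (fourier_coeff N (\<lambda>\<zeta>. f \<zeta> + ?h \<zeta>) \<alpha>))\<^sup>2" for \<alpha>
      using disj[of \<alpha>] by (auto simp: fourier_coeff_add L2_integrable f ch fourier_coeff_scale)
    ultimately have "((\<lambda>\<alpha>. (cmod (fourier_coeff N (\<lambda>\<zeta>. f \<zeta> + ?h \<zeta>) \<alpha>))\<^sup>2) has_sum
        (L2_normsq (torus N) f + L2_normsq (torus N) ?h)) (multi_indices N)"
      by simp
    from has_sum_unique[OF this parseval[OF L2_add[OF f ch]]]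
    show ?thesis using L2_normsq_add[OF f ch] by simp
  qed
  show ?thesis
    using *[of 1] *[of \<i>] unfolding L2_inner_scale_right by (simp add: complex_eq_iff)
qed

section \<open>The Hardy space and its multipliers\<close>

lemma H2_L2: "f \<in> H2 N \<Longrightarrow> f \<in> L2_space (torus N)"
  by (simp add: H2_def)

lemma monomial_H2:
  assumes "\<And>j. j < N \<Longrightarrow> \<alpha> j \<ge> 0" shows "monomial N \<alpha> \<in> H2 N"
  using assms by (auto simp: H2_def monomial_L2 fourier_coeff_monomial) 

lemma one_H2: "(\<lambda>_. 1) \<in> H2 N"
proof -
  have "monomial N (\<lambda>_. 0) = (\<lambda>_. 1)" by (simp add: fun_eq_iff)
  then show ?thesis using monomial_H2[of N "\<lambda>_. 0"] by simp
qed

lemma H2_projection_exists: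
  assumes u: "u \<in> L2_space (torus N)"
  shows "\<exists>p\<in>H2 N. \<forall>f\<in>H2 N. L2_inner (torus N) f p = L2_inner (torus N) f u"
proof -
  let ?Y = "{\<alpha> \<in> multi_indices N. \<forall>j<N. \<alpha> j \<ge> 0}"
  obtain p where p: "p \<in> L2_space (torus N)"
    "\<And>\<alpha>. \<alpha> \<in> multi_indices N \<Longrightarrow> fourier_coeff N p \<alpha> = (if \<alpha> \<in> ?Y then fourier_coeff N u \<alpha> else 0)"
    by (rule riesz_fischer_projection[OF u, of ?Y]) auto
  have pc: "fourier_coeff N p \<alpha> = (if \<forall>j<N. \<alpha> j \<ge> 0 then fourier_coeff N u \<alpha> else 0)" for \<alpha>
    using p(2)[OF restrict_in_multi_indices, of \<alpha>] restrict_in_multi_indices[of \<alpha> N]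
    by (auto simp: fourier_coeff_restrict split: if_splits)
  have "p \<in> H2 N" using p(1) by (auto simp: H2_def pc)
  moreover have "L2_inner (torus N) f p = L2_inner (torus N) f u" if f: "f \<in> H2 N" for f
  proof -
    have "L2_inner (torus N) f (\<lambda>\<zeta>. p \<zeta> - u \<zeta>) = 0"
    proof (rule L2_inner_eq_0_if_disjoint_spectra[OF H2_L2[OF f] L2_diff[OF p(1) u]])
      fix \<alpha>
      show "fourier_coeff N f \<alpha> = 0 \<or> fourier_coeff N (\<lambda>\<zeta>. p \<zeta> - u \<zeta>) \<alpha> = 0"
        using f by (auto simp: fourier_coeff_diff L2_integrable p(1) u pc H2_def)
    qed
    then show ?thesis by (simp add: L2_inner_diff_right[OF H2_L2[OF f] p(1) u])
  qed
  ultimately show ?thesis by blast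
qed

text \<open>The coefficient of \<open>\<phi> f\<close> at \<open>\<alpha>\<close> is the inner product of \<open>f\<close> with \<open>h = cnj \<phi> * \<zeta>\<^sup>\<alpha>\<close>, whose coefficient at \<open>\<beta>\<close> is
  the conjugate of that of \<open>\<phi>\<close> at \<open>\<alpha> - \<beta>\<close>. If \<open>\<alpha>\<close> has a negative entry and \<open>\<beta>\<close> has none, then \<open>\<alpha> - \<beta>\<close> has a
  negative entry, so \<open>f\<close> and \<open>h\<close> have disjoint spectra.\<close>

lemma Hinf_mult_H2:
  assumes \<phi>: "\<phi> \<in> Hinf N" and f: "f \<in> H2 N"
  shows "(\<lambda>\<zeta>. \<phi> \<zeta> * f \<zeta>) \<in> H2 N"
proof -
  obtain C where C: "AE \<zeta> in torus N. cmod (\<phi> \<zeta>) \<le> C" using \<phi> by (auto simp: Hinf_def)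
  have \<phi>H: "\<phi> \<in> H2 N" using \<phi> by (simp add: Hinf_def)
  have L: "(\<lambda>\<zeta>. \<phi> \<zeta> * f \<zeta>) \<in> L2_space (torus N)"
    using L2_mult_bounded[OF H2_L2[OF f] L2_measurable[OF H2_L2[OF \<phi>H]] C] by (simp add: mult.commute)
  have "fourier_coeff N (\<lambda>\<zeta>. \<phi> \<zeta> * f \<zeta>) \<alpha> = 0" if \<alpha>: "\<not> (\<forall>j<N. \<alpha> j \<ge> 0)" for \<alpha>
  proof -
    let ?h = "\<lambda>\<zeta>. cnj (\<phi> \<zeta>) * monomial N \<alpha> \<zeta>"
    have h: "?h \<in> L2_space (torus N)"
      by (rule L2_mult_bounded[OF L2_cnj[OF H2_L2[OF \<phi>H]] monomial_measurable AE_cmod_monomial])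
    have hc: "fourier_coeff N ?h \<beta> = cnj (fourier_coeff N \<phi> (\<lambda>j. \<alpha> j - \<beta> j))" for \<beta>
    proof -
      have "fourier_coeff N ?h \<beta> = (LINT \<zeta>|torus N. cnj (\<phi> \<zeta> * monomial N (\<lambda>j. - (\<alpha> j - \<beta> j)) \<zeta>))"
        unfolding fourier_coeff_def
      proof (intro Bochner_Integration.integral_cong refl)
        fix \<zeta> assume z: "\<zeta> \<in> space (torus N)"
        have "cnj (monomial N (\<lambda>j. - (\<alpha> j - \<beta> j)) \<zeta>) = monomial N (\<lambda>j. \<alpha> j - \<beta> j) \<zeta>"
          using monomial_uminus[OF z, of "\<lambda>j. \<alpha> j - \<beta> j"] by simp
        also have "\<dots> = monomial N \<alpha> \<zeta> * monomial N (\<lambda>j. - \<beta> j) \<zeta>"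
          by (simp add: monomial_add[OF z])
        finally show "cnj (\<phi> \<zeta>) * monomial N \<alpha> \<zeta> * monomial N (\<lambda>j. - \<beta> j) \<zeta>
            = cnj (\<phi> \<zeta> * monomial N (\<lambda>j. - (\<alpha> j - \<beta> j)) \<zeta>)" by simp
      qed
      also have "\<dots> = cnj (fourier_coeff N \<phi> (\<lambda>j. \<alpha> j - \<beta> j))"
        unfolding fourier_coeff_def by (rule Bochner_Integration.integral_cnj)
      finally show ?thesis .
    qed
    have "fourier_coeff N (\<lambda>\<zeta>. \<phi> \<zeta> * f \<zeta>) \<alpha> = L2_inner (torus N) f ?h"
      unfolding fourier_coeff_eq_inner L2_inner_def
      by (intro Bochner_Integration.integral_cong refl) (simp add: mult_ac)
    also have "\<dots> = 0"
    proof (rule L2_inner_eq_0_if_disjoint_spectra[OF H2_L2[OF f] h])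
      fix \<beta>
      show "fourier_coeff N f \<beta> = 0 \<or> fourier_coeff N ?h \<beta> = 0"
      proof (cases "\<forall>j<N. \<beta> j \<ge> 0")
        case True
        with \<alpha> have "\<not> (\<forall>j<N. \<alpha> j - \<beta> j \<ge> 0)" by (meson diff_ge_0_iff_ge order_trans)
        then show ?thesis using \<phi>H by (auto simp: hc H2_def)
      qed (use f in \<open>auto simp: H2_def\<close>)
    qed
    finally show ?thesis .
  qed
  with L show ?thesis by (simp add: H2_def)
qed

lemma Hinf_power_mult_H2:
  assumes \<phi>: "\<phi> \<in> Hinf N" and f: "f \<in> H2 N"
  shows "(\<lambda>\<zeta>. \<phi> \<zeta> ^ n * f \<zeta>) \<in> H2 N"
proof (induction n)
  case (Suc n)
  from Hinf_mult_H2[OF \<phi> Suc] show ?case by (simp add: mult.assoc)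
qed (use f in simp)

text \<open>The adjoint is specified by a choice, so its properties rest on the existence of one admissible
  value: the projection of \<open>g * cnj \<phi>\<close> to \<open>H\<^sup>2\<close>.\<close>

lemma mult_adj:
  assumes \<phi>: "\<phi> \<in> Hinf N" and g: "g \<in> H2 N"
  shows mult_adj_H2: "mult_adj N \<phi> g \<in> H2 N"
    and inner_mult_adj: "f \<in> H2 N \<Longrightarrow>
      L2_inner (torus N) f (mult_adj N \<phi> g) = L2_inner (torus N) (\<lambda>\<zeta>. \<phi> \<zeta> * f \<zeta>) g"
proof -
  obtain C where C: "AE \<zeta> in torus N. cmod (\<phi> \<zeta>) \<le> C" using \<phi> by (auto simp: Hinf_def)
  have \<phi>H: "\<phi> \<in> H2 N" using \<phi> by (simp add: Hinf_def)
  have "(\<lambda>\<zeta>. g \<zeta> * cnj (\<phi> \<zeta>)) \<in> L2_space (torus N)"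
    using L2_mult_bounded[OF H2_L2[OF g] borel_measurable_cnj[OF L2_measurable[OF H2_L2[OF \<phi>H]]]] C by simp
  from H2_projection_exists[OF this] obtain p where p: "p \<in> H2 N"
    "\<forall>f\<in>H2 N. L2_inner (torus N) f p = L2_inner (torus N) f (\<lambda>\<zeta>. g \<zeta> * cnj (\<phi> \<zeta>))" by blast
  have "L2_inner (torus N) f (\<lambda>\<zeta>. g \<zeta> * cnj (\<phi> \<zeta>)) = L2_inner (torus N) (mult_op \<phi> f) g" for f
    unfolding L2_inner_def mult_op_def
    by (intro Bochner_Integration.integral_cong refl) (simp add: mult_ac)
  with p have "p \<in> H2 N \<and> (\<forall>f\<in>H2 N. L2_inner (torus N) (mult_op \<phi> f) g = L2_inner (torus N) f p)"
    by simp
  then have "mult_adj N \<phi> g \<in> H2 N \<and>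
      (\<forall>f\<in>H2 N. L2_inner (torus N) (mult_op \<phi> f) g = L2_inner (torus N) f (mult_adj N \<phi> g))"
    unfolding mult_adj_def L2_adjoint_def by (rule someI[where P = "\<lambda>h. h \<in> H2 N \<and>
      (\<forall>f\<in>H2 N. L2_inner (torus N) (mult_op \<phi> f) g = L2_inner (torus N) f h)"])
  then show "mult_adj N \<phi> g \<in> H2 N" "f \<in> H2 N \<Longrightarrow>
      L2_inner (torus N) f (mult_adj N \<phi> g) = L2_inner (torus N) (\<lambda>\<zeta>. \<phi> \<zeta> * f \<zeta>) g"
    by (auto simp: mult_op_def)
qed

lemma mult_adj_funpow_H2:
  assumes "\<phi> \<in> Hinf N" "g \<in> H2 N"
  shows "(mult_adj N \<phi> ^^ n) g \<in> H2 N"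
  by (induction n) (auto intro: assms mult_adj_H2)

lemma inner_mult_adj_funpow:
  assumes \<phi>: "\<phi> \<in> Hinf N" and g: "g \<in> H2 N" and f: "f \<in> H2 N"
  shows "L2_inner (torus N) f ((mult_adj N \<phi> ^^ n) g) = L2_inner (torus N) (\<lambda>\<zeta>. \<phi> \<zeta> ^ n * f \<zeta>) g"
  using f
proof (induction n arbitrary: f)
  case (Suc n)
  have "L2_inner (torus N) f ((mult_adj N \<phi> ^^ Suc n) g)
      = L2_inner (torus N) (\<lambda>\<zeta>. \<phi> \<zeta> * f \<zeta>) ((mult_adj N \<phi> ^^ n) g)"
    using inner_mult_adj[OF \<phi> mult_adj_funpow_H2[OF \<phi> g] Suc.prems] by simp
  also have "\<dots> = L2_inner (torus N) (\<lambda>\<zeta>. \<phi> \<zeta> ^ Suc n * f \<zeta>) g"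
    using Suc.IH[OF Hinf_mult_H2[OF \<phi> Suc.prems]] by (simp add: mult_ac)
  finally show ?case .
qed simp

section \<open>Orbit frames\<close>

text \<open>The squared frame coefficients of \<open>y\<close>, with the powers of the adjoint moved to the other side of
  the inner product. In this form they do not depend on the representatives chosen for the
  iterates of the adjoint.\<close>

definition orbit_coeff_sq ::
  "nat \<Rightarrow> ((nat \<Rightarrow> complex) \<Rightarrow> complex) \<Rightarrow> ('i \<Rightarrow> (nat \<Rightarrow> complex) \<Rightarrow> complex)
    \<Rightarrow> ((nat \<Rightarrow> complex) \<Rightarrow> complex) \<Rightarrow> 'i \<times> nat \<Rightarrow> real" where
  "orbit_coeff_sq N \<phi> g y = (\<lambda>(i, n). (cmod (L2_inner (torus N) (\<lambda>\<zeta>. \<phi> \<zeta> ^ n * y \<zeta>) (g i)))\<^sup>2)"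

lemma orbit_coeff_sq_nonneg: "0 \<le> orbit_coeff_sq N \<phi> g y x"
  by (simp add: orbit_coeff_sq_def case_prod_beta)

lemma orbit_coeff_sq_shift:
  "orbit_coeff_sq N \<phi> g (\<lambda>\<zeta>. \<phi> \<zeta> ^ k * y \<zeta>) (i, n) = orbit_coeff_sq N \<phi> g y (i, n + k)"
  by (simp add: orbit_coeff_sq_def power_add mult.assoc)

lemma orbit_frame_iff:
  assumes \<phi>: "\<phi> \<in> Hinf N"
  shows "orbit_frame N \<phi> I g \<longleftrightarrow> countable I \<and> (\<forall>i\<in>I. g i \<in> H2 N) \<and>
    (\<exists>A>0. \<exists>B>0. \<forall>y\<in>H2 N. orbit_coeff_sq N \<phi> g y summable_on I \<times> UNIV \<and>
      A * L2_normsq (torus N) y \<le> infsum (orbit_coeff_sq N \<phi> g y) (I \<times> UNIV) \<and>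
      infsum (orbit_coeff_sq N \<phi> g y) (I \<times> UNIV) \<le> B * L2_normsq (torus N) y)"
proof (cases "countable I \<and> (\<forall>i\<in>I. g i \<in> H2 N)")
  case True
  let ?x = "\<lambda>(i, n). (mult_adj N \<phi> ^^ n) (g i)"
  let ?Q = "\<lambda>y j. (cmod (L2_inner (torus N) y (?x j)))\<^sup>2"
  have eq: "?Q y j = orbit_coeff_sq N \<phi> g y j" if "y \<in> H2 N" "j \<in> I \<times> UNIV" for y j
    using that True by (auto simp: orbit_coeff_sq_def inner_mult_adj_funpow[OF \<phi>])
  have s: "?Q y summable_on I \<times> UNIV \<longleftrightarrow> orbit_coeff_sq N \<phi> g y summable_on I \<times> UNIV"
    if "y \<in> H2 N" for y
    by (intro summable_on_cong eq that)
  have i: "infsum (?Q y) (I \<times> UNIV) = infsum (orbit_coeff_sq N \<phi> g y) (I \<times> UNIV)"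
    if "y \<in> H2 N" for y
    by (intro infsum_cong eq that)
  have "countable (I \<times> (UNIV :: nat set))" "\<forall>j\<in>I \<times> UNIV. ?x j \<in> H2 N"
    using True by (auto intro: mult_adj_funpow_H2[OF \<phi>])
  moreover have bounds: "(\<forall>y\<in>H2 N. ?Q y summable_on I \<times> UNIV \<and>
      A * L2_normsq (torus N) y \<le> infsum (?Q y) (I \<times> UNIV) \<and>
      infsum (?Q y) (I \<times> UNIV) \<le> B * L2_normsq (torus N) y) \<longleftrightarrow>
    (\<forall>y\<in>H2 N. orbit_coeff_sq N \<phi> g y summable_on I \<times> UNIV \<and>
      A * L2_normsq (torus N) y \<le> infsum (orbit_coeff_sq N \<phi> g y) (I \<times> UNIV) \<and>
      infsum (orbit_coeff_sq N \<phi> g y) (I \<times> UNIV) \<le> B * L2_normsq (torus N) y)" for A B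
    by (intro ball_cong refl) (simp only: s i)
  ultimately show ?thesis
    unfolding orbit_frame_def is_frame_def L2_norm_power2 bounds using True by blast
qed (auto simp: orbit_frame_def)

lemma tail_infsum_tendsto_0:
  fixes f :: "'i \<times> nat \<Rightarrow> real"
  assumes s: "f summable_on I \<times> UNIV" and nn: "\<And>x. 0 \<le> f x"
  shows "(\<lambda>k. infsum f (I \<times> {k..})) \<longlonglongrightarrow> 0"
proof (rule LIMSEQ_I)
  fix e :: real assume "e > 0"
  have sub: "f summable_on X" if "X \<subseteq> I \<times> UNIV" for X
    by (rule summable_on_subset_banach[OF s that])
  from infsum_finite_approximation[OF s, of "e / 2"] \<open>e > 0\<close> obtain F where
    F: "finite F" "F \<subseteq> I \<times> UNIV" "dist (sum f F) (infsum f (I \<times> UNIV)) \<le> e / 2" by auto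
  define K where "K = Suc (Max (insert 0 (snd ` F)))"
  have K: "snd x < K" if "x \<in> F" for x
    using that F(1) by (auto simp: K_def less_Suc_eq_le)
  show "\<exists>no. \<forall>k\<ge>no. norm (infsum f (I \<times> {k..}) - 0) < e"
  proof (intro exI[of _ K] allI impI)
    fix k assume k: "K \<le> k"
    have "I \<times> UNIV = I \<times> {..<k} \<union> I \<times> {k..}" by auto
    also have "infsum f \<dots> = infsum f (I \<times> {..<k}) + infsum f (I \<times> {k..})"
      by (rule infsum_Un_disjoint) (auto intro: sub)
    finally have "infsum f (I \<times> UNIV) = infsum f (I \<times> {..<k}) + infsum f (I \<times> {k..})" .
    moreover have "sum f F \<le> infsum f (I \<times> {..<k})"
    proof (rule finite_sum_le_infsum)
      show "f summable_on I \<times> {..<k}" by (rule sub) auto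
      show "F \<subseteq> I \<times> {..<k}" using F(2) K k by fastforce
    qed (use F(1) nn in auto)
    moreover have "0 \<le> infsum f (I \<times> {k..})" by (rule infsum_nonneg) (rule nn)
    ultimately show "norm (infsum f (I \<times> {k..}) - 0) < e"
      using F(3) \<open>e > 0\<close> by (simp add: dist_real_def)
  qed
qed

lemma infsum_orbit_coeff_sq_shift:
  "infsum (orbit_coeff_sq N \<phi> g (\<lambda>\<zeta>. \<phi> \<zeta> ^ k * y \<zeta>)) (I \<times> UNIV)
    = infsum (orbit_coeff_sq N \<phi> g y) (I \<times> {k..})"
proof -
  have bij: "bij_betw (\<lambda>(i, n). (i, n + k)) (I \<times> UNIV) (I \<times> {k..})"
    by (rule bij_betwI[where g = "\<lambda>(i, n). (i, n - k)"]) auto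
  show ?thesis
    unfolding infsum_reindex_bij_betw[OF bij, symmetric]
    by (intro infsum_cong) (auto simp: orbit_coeff_sq_shift)
qed

text \<open>The frame sum of \<open>\<phi>\<^sup>k y\<close> is the tail, from \<open>n = k\<close> on, of the convergent frame sum of \<open>y\<close>.\<close>

lemma orbit_frame_imp_powers_tendsto_0:
  assumes \<phi>: "\<phi> \<in> Hinf N" and fr: "orbit_frame N \<phi> I g" and y: "y \<in> H2 N"
  shows "(\<lambda>k. L2_normsq (torus N) (\<lambda>\<zeta>. \<phi> \<zeta> ^ k * y \<zeta>)) \<longlonglongrightarrow> 0"
proof -
  let ?q = "orbit_coeff_sq N \<phi> g"
  from fr obtain A where A: "A > 0" and s: "\<And>y. y \<in> H2 N \<Longrightarrow> ?q y summable_on I \<times> UNIV"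
    and lower: "\<And>y. y \<in> H2 N \<Longrightarrow> A * L2_normsq (torus N) y \<le> infsum (?q y) (I \<times> UNIV)"
    unfolding orbit_frame_iff[OF \<phi>] by blast
  show ?thesis
  proof (rule Lim_null_comparison[OF always_eventually])
    show "(\<lambda>k. infsum (?q y) (I \<times> {k..}) / A) \<longlonglongrightarrow> 0"
      using tendsto_divide[OF tail_infsum_tendsto_0[OF s[OF y] orbit_coeff_sq_nonneg] tendsto_const] A
      by fastforce
    show "\<forall>k. norm (L2_normsq (torus N) (\<lambda>\<zeta>. \<phi> \<zeta> ^ k * y \<zeta>)) \<le> infsum (?q y) (I \<times> {k..}) / A"
    proof
      fix k
      have "A * L2_normsq (torus N) (\<lambda>\<zeta>. \<phi> \<zeta> ^ k * y \<zeta>) \<le> infsum (?q y) (I \<times> {k..})"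
        using lower[OF Hinf_power_mult_H2[OF \<phi> y, of k]] unfolding infsum_orbit_coeff_sq_shift .
      then have "L2_normsq (torus N) (\<lambda>\<zeta>. \<phi> \<zeta> ^ k * y \<zeta>) \<le> infsum (?q y) (I \<times> {k..}) / A"
        unfolding pos_le_divide_eq[OF A] by (simp only: mult.commute)
      then show "norm (L2_normsq (torus N) (\<lambda>\<zeta>. \<phi> \<zeta> ^ k * y \<zeta>)) \<le> infsum (?q y) (I \<times> {k..}) / A"
        by simp
    qed
  qed
qed

lemma orbit_frame_imp_less_1:
  assumes \<phi>: "\<phi> \<in> Hinf N" and fr: "orbit_frame N \<phi> I g"
  shows "AE \<zeta> in torus N. cmod (\<phi> \<zeta>) < 1"
proof -
  have \<phi>H: "\<phi> \<in> H2 N" using \<phi> by (simp add: Hinf_def)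
  note [measurable] = L2_measurable[OF H2_L2[OF \<phi>H]]
  define E where "E = {\<zeta> \<in> space (torus N). 1 \<le> cmod (\<phi> \<zeta>)}"
  have E[measurable]: "E \<in> sets (torus N)" unfolding E_def by measurable
  have "measure (torus N) E \<le> L2_normsq (torus N) (\<lambda>\<zeta>. \<phi> \<zeta> ^ k * 1)" for k
  proof -
    have "measure (torus N) E = (LINT \<zeta>|torus N. indicator E \<zeta>)" by simp
    also have "\<dots> \<le> L2_normsq (torus N) (\<lambda>\<zeta>. \<phi> \<zeta> ^ k * 1)"
    proof (rule integral_mono)
      show "integrable (torus N) (\<lambda>\<zeta>. (cmod (\<phi> \<zeta> ^ k * 1))\<^sup>2)"
        by (rule L2_integrable_square[OF H2_L2[OF Hinf_power_mult_H2[OF \<phi> one_H2]]])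
      show "indicator E \<zeta> \<le> (cmod (\<phi> \<zeta> ^ k * 1))\<^sup>2" for \<zeta>
        by (auto simp: indicator_def E_def norm_power intro!: one_le_power)
    qed (simp add: integrable_real_indicator torus.emeasure_finite less_top[symmetric])
    finally show ?thesis .
  qed
  then have "measure (torus N) E \<le> 0"
    by (intro LIMSEQ_le_const[OF orbit_frame_imp_powers_tendsto_0[OF \<phi> fr one_H2]]) auto
  then have "measure (torus N) E = 0" by (simp add: order_antisym)
  then have "E \<in> null_sets (torus N)" by (simp add: null_sets_def torus.emeasure_eq_measure)
  then have "AE \<zeta> in torus N. \<zeta> \<notin> E" by (rule AE_not_in)
  then show ?thesis using AE_space by eventually_elim (auto simp: E_def)
qed

text \<open>The powers of one coordinate are orthonormal, hence converge weakly to zero by Bessel's inequality.\<close>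

lemma fourier_coeff_axis_tendsto_0:
  assumes u: "u \<in> L2_space (torus N)" and N: "j < N"
  shows "(\<lambda>m. fourier_coeff N u (\<lambda>i. if i = j then int m else 0)) \<longlonglongrightarrow> 0"
proof -
  define \<alpha> where "\<alpha> m = restrict (\<lambda>i. if i = j then int m else 0) {..<N}" for m
  have inj: "inj_on \<alpha> X" for X
  proof (rule inj_onI)
    fix m n assume "\<alpha> m = \<alpha> n"
    then have "\<alpha> m j = \<alpha> n j" by simp
    then show "m = n" using N by (simp add: \<alpha>_def)
  qed
  have "(\<Sum>m<n. (cmod (fourier_coeff N u (\<alpha> m)))\<^sup>2) \<le> L2_normsq (torus N) u" for n
  proof -
    have "\<alpha> ` {..<n} \<subseteq> multi_indices N" by (auto simp: \<alpha>_def restrict_in_multi_indices)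
    from bessel_inequality[OF _ this u] show ?thesis by (simp add: sum.reindex[OF inj])
  qed
  then have "summable (\<lambda>m. (cmod (fourier_coeff N u (\<alpha> m)))\<^sup>2)"
    by (intro summableI_nonneg_bounded) auto
  then have "(\<lambda>m. (cmod (fourier_coeff N u (\<alpha> m)))\<^sup>2) \<longlonglongrightarrow> 0" by (rule summable_LIMSEQ_zero)
  then have "(\<lambda>m. sqrt ((cmod (fourier_coeff N u (\<alpha> m)))\<^sup>2)) \<longlonglongrightarrow> sqrt 0" by (rule tendsto_real_sqrt)
  then have "(\<lambda>m. fourier_coeff N u (\<alpha> m)) \<longlonglongrightarrow> 0" by (simp add: tendsto_norm_zero_iff)
  then show ?thesis by (simp add: \<alpha>_def fourier_coeff_restrict)
qed

text \<open>The powers of the first coordinate lose all contact with finitely many vectors \<open>cnj \<phi>\<^sup>n * g\<^sub>i\<close>, while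
  the rest of their frame sum is controlled by the upper frame bound and \<open>\<parallel>\<phi>\<^sup>K\<parallel>\<close>.\<close>

lemma orbit_frame_imp_infinite:
  assumes N: "1 \<le> N" and \<phi>: "\<phi> \<in> Hinf N" and fr: "orbit_frame N \<phi> I g"
  shows "infinite I"
proof
  assume fin: "finite I"
  let ?q = "orbit_coeff_sq N \<phi> g"
  let ?nsq = "L2_normsq (torus N)"
  from fr obtain A B where g: "\<And>i. i \<in> I \<Longrightarrow> g i \<in> H2 N" and A: "A > 0" and B: "B > 0"
    and s: "\<And>y. y \<in> H2 N \<Longrightarrow> ?q y summable_on I \<times> UNIV"
    and lower: "\<And>y. y \<in> H2 N \<Longrightarrow> A * ?nsq y \<le> infsum (?q y) (I \<times> UNIV)"
    and upper: "\<And>y. y \<in> H2 N \<Longrightarrow> infsum (?q y) (I \<times> UNIV) \<le> B * ?nsq y"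
    unfolding orbit_frame_iff[OF \<phi>] by blast
  define e where "e m = monomial N (\<lambda>i. if i = 0 then int m else 0)" for m
  have eH: "e m \<in> H2 N" for m unfolding e_def by (rule monomial_H2) simp
  have e1: "cmod (e m \<zeta>) = 1" if "\<zeta> \<in> space (torus N)" for m \<zeta>
    unfolding e_def by (rule cmod_monomial[OF that])
  have nsq: "?nsq (\<lambda>\<zeta>. \<phi> \<zeta> ^ k * e m \<zeta>) = ?nsq (\<lambda>\<zeta>. \<phi> \<zeta> ^ k * 1)" for k m
    by (intro Bochner_Integration.integral_cong refl) (simp add: norm_mult e1)
  have qlim: "(\<lambda>m. ?q (e m) (i, n)) \<longlonglongrightarrow> 0" if "i \<in> I" for i n
  proof -
    have "\<exists>C. AE \<zeta> in torus N. cmod (\<phi> \<zeta>) \<le> C" using \<phi> by (auto simp: Hinf_def)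
    then obtain C where C: "AE \<zeta> in torus N. cmod (\<phi> \<zeta>) \<le> C" by blast
    have \<phi>m: "\<phi> \<in> borel_measurable (torus N)" using \<phi> by (auto simp: Hinf_def intro: L2_measurable H2_L2)
    have u: "(\<lambda>\<zeta>. g i \<zeta> * cnj (\<phi> \<zeta> ^ n)) \<in> L2_space (torus N)"
    proof (rule L2_mult_bounded[OF H2_L2[OF g[OF that]]])
      show "(\<lambda>\<zeta>. cnj (\<phi> \<zeta> ^ n)) \<in> borel_measurable (torus N)"
        using \<phi>m by (intro borel_measurable_cnj borel_measurable_power)
      show "AE \<zeta> in torus N. cmod (cnj (\<phi> \<zeta> ^ n)) \<le> C ^ n"
        using C by eventually_elim (auto simp: norm_power intro!: power_mono)
    qed
    have "L2_inner (torus N) (\<lambda>\<zeta>. \<phi> \<zeta> ^ n * e m \<zeta>) (g i)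
        = cnj (fourier_coeff N (\<lambda>\<zeta>. g i \<zeta> * cnj (\<phi> \<zeta> ^ n)) (\<lambda>i. if i = 0 then int m else 0))" for m
      unfolding fourier_coeff_eq_inner L2_inner_def Bochner_Integration.integral_cnj[symmetric]
      by (intro Bochner_Integration.integral_cong refl) (simp add: e_def mult_ac)
    then have "?q (e m) (i, n)
        = (cmod (fourier_coeff N (\<lambda>\<zeta>. g i \<zeta> * cnj (\<phi> \<zeta> ^ n)) (\<lambda>i. if i = 0 then int m else 0)))\<^sup>2" for m
      by (simp add: orbit_coeff_sq_def del: complex_cnj_power)
    moreover have "(\<lambda>m. (cmod (fourier_coeff N (\<lambda>\<zeta>. g i \<zeta> * cnj (\<phi> \<zeta> ^ n)) (\<lambda>i. if i = 0 then int m else 0)))\<^sup>2)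
        \<longlonglongrightarrow> (cmod 0)\<^sup>2"
      by (intro tendsto_intros fourier_coeff_axis_tendsto_0[OF u]) (use N in simp)
    ultimately show ?thesis by simp
  qed
  \<comment> \<open>split the frame sum of \<open>e m\<close> at \<open>n = K\<close>, then let \<open>m\<close> tend to infinity\<close>
  have le: "A \<le> B * ?nsq (\<lambda>\<zeta>. \<phi> \<zeta> ^ K * 1)" for K
  proof -
    have bound: "A \<le> sum (?q (e m)) (I \<times> {..<K}) + B * ?nsq (\<lambda>\<zeta>. \<phi> \<zeta> ^ K * 1)" for m
    proof -
      have "A = A * ?nsq (\<lambda>\<zeta>. \<phi> \<zeta> ^ 0 * e m \<zeta>)"
        unfolding nsq by (simp add: torus.prob_space)
      also have "\<dots> \<le> infsum (?q (e m)) (I \<times> UNIV)"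
        using lower[OF eH, of m] by simp
      also have "I \<times> UNIV = I \<times> {..<K} \<union> I \<times> {K..}" by auto
      also have "infsum (?q (e m)) \<dots> = infsum (?q (e m)) (I \<times> {..<K}) + infsum (?q (e m)) (I \<times> {K..})"
        by (rule infsum_Un_disjoint) (auto intro: summable_on_subset_banach[OF s[OF eH]])
      also have "infsum (?q (e m)) (I \<times> {..<K}) = sum (?q (e m)) (I \<times> {..<K})"
        using fin by simp
      also have "infsum (?q (e m)) (I \<times> {K..}) \<le> B * ?nsq (\<lambda>\<zeta>. \<phi> \<zeta> ^ K * 1)"
        using upper[OF Hinf_power_mult_H2[OF \<phi> eH], of K m]
        unfolding infsum_orbit_coeff_sq_shift nsq .
      finally show ?thesis by simp
    qed
    have "(\<lambda>m. sum (?q (e m)) (I \<times> {..<K}) + B * ?nsq (\<lambda>\<zeta>. \<phi> \<zeta> ^ K * 1))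
        \<longlonglongrightarrow> (\<Sum>x\<in>I \<times> {..<K}. 0) + B * ?nsq (\<lambda>\<zeta>. \<phi> \<zeta> ^ K * 1)"
      by (intro tendsto_add tendsto_const tendsto_sum) (auto intro: qlim)
    from LIMSEQ_le_const[OF this] bound show ?thesis by auto
  qed
  have "(\<lambda>K. B * ?nsq (\<lambda>\<zeta>. \<phi> \<zeta> ^ K * 1)) \<longlonglongrightarrow> B * 0"
    by (intro tendsto_mult tendsto_const orbit_frame_imp_powers_tendsto_0[OF \<phi> fr one_H2])
  from LIMSEQ_le_const[OF this] le have "A \<le> 0" by auto
  with A show False by simp
qed

lemma L2_powers_tendsto_0:
  assumes \<phi>: "\<phi> \<in> borel_measurable M" "AE x in M. cmod (\<phi> x) < 1" and y: "y \<in> L2_space M"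
  shows "(\<lambda>k. L2_normsq M (\<lambda>x. \<phi> x ^ k * y x)) \<longlonglongrightarrow> 0"
proof -
  note [measurable] = \<phi>(1) L2_measurable[OF y]
  have "(\<lambda>k. L2_normsq M (\<lambda>x. \<phi> x ^ k * y x)) \<longlonglongrightarrow> (LINT x|M. 0)"
  proof (rule integral_dominated_convergence[where w = "\<lambda>x. (cmod (y x))\<^sup>2"])
    show "integrable M (\<lambda>x. (cmod (y x))\<^sup>2)" by (rule L2_integrable_square[OF y])
    show "AE x in M. (\<lambda>k. (cmod (\<phi> x ^ k * y x))\<^sup>2) \<longlonglongrightarrow> 0"
      using \<phi>(2)
    proof eventually_elim
      case (elim x)
      have "(\<lambda>k. (cmod (\<phi> x ^ k * y x))\<^sup>2) \<longlonglongrightarrow> (cmod (0 * y x))\<^sup>2"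
        by (intro tendsto_intros LIMSEQ_power_zero elim)
      then show ?case by simp
    qed
    show "AE x in M. norm ((cmod (\<phi> x ^ k * y x))\<^sup>2) \<le> (cmod (y x))\<^sup>2" for k
      using \<phi>(2)
    proof eventually_elim
      case (elim x)
      then have "cmod (\<phi> x) ^ k * cmod (y x) \<le> 1 * cmod (y x)"
        by (intro mult_right_mono power_le_one) auto
      then show ?case by (simp add: norm_mult norm_power power_mono)
    qed
  qed measurable
  then show ?thesis by simp
qed

text \<open>A system with frame operator \<open>1 - M\<^sub>\<phi>\<^sup>* M\<^sub>\<phi>\<close>. Working in all of \<open>L\<^sup>2\<close> with the multiplication by
  \<open>w = (1 - |\<phi>|\<^sup>2)\<^sup>1\<^sup>/\<^sup>2\<close> and projecting afterwards avoids the square root of an operator on \<open>H\<^sup>2\<close>.\<close>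

lemma defect_parseval_family:
  assumes \<phi>: "\<phi> \<in> Hinf N" and lt: "AE \<zeta> in torus N. cmod (\<phi> \<zeta>) < 1"
  shows "\<exists>G. (\<forall>\<alpha>. G \<alpha> \<in> H2 N) \<and>
    (\<forall>f\<in>H2 N. ((\<lambda>\<alpha>. (cmod (L2_inner (torus N) f (G \<alpha>)))\<^sup>2) has_sum
      (L2_normsq (torus N) f - L2_normsq (torus N) (\<lambda>\<zeta>. \<phi> \<zeta> * f \<zeta>))) (multi_indices N))"
proof -
  have \<phi>m[measurable]: "\<phi> \<in> borel_measurable (torus N)"
    using \<phi> by (auto simp: Hinf_def intro: L2_measurable H2_L2)
  \<comment> \<open>the maximum only matters on the null set where \<open>|\<phi>| > 1\<close>; it makes \<open>0 \<le> w \<le> 1\<close> hold everywhere\<close>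
  define w where "w \<zeta> = complex_of_real (sqrt (max 0 (1 - (cmod (\<phi> \<zeta>))\<^sup>2)))" for \<zeta>
  have wm[measurable]: "w \<in> borel_measurable (torus N)" unfolding w_def by measurable
  have w1: "cmod (w \<zeta>) \<le> 1" for \<zeta> by (simp add: w_def)
  have "(\<lambda>\<zeta>. monomial N \<alpha> \<zeta> * w \<zeta>) \<in> L2_space (torus N)" for \<alpha>
    by (rule L2_mult_bounded[OF monomial_L2 wm, of 1]) (use w1 in auto)
  from H2_projection_exists[OF this]
  have "\<forall>\<alpha>. \<exists>p. p \<in> H2 N \<and>
      (\<forall>f\<in>H2 N. L2_inner (torus N) f p = L2_inner (torus N) f (\<lambda>\<zeta>. monomial N \<alpha> \<zeta> * w \<zeta>))"
    by blast
  from choice[OF this] obtain G where G: "\<And>\<alpha>. G \<alpha> \<in> H2 N"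
    "\<And>\<alpha> f. f \<in> H2 N \<Longrightarrow> L2_inner (torus N) f (G \<alpha>) = L2_inner (torus N) f (\<lambda>\<zeta>. monomial N \<alpha> \<zeta> * w \<zeta>)"
    by blast
  show ?thesis
  proof (intro exI[of _ G] conjI allI ballI)
    show "G \<alpha> \<in> H2 N" for \<alpha> by (rule G(1))
    fix f assume f: "f \<in> H2 N"
    have fw: "(\<lambda>\<zeta>. f \<zeta> * w \<zeta>) \<in> L2_space (torus N)"
      by (rule L2_mult_bounded[OF H2_L2[OF f] wm, of 1]) (use w1 in auto)
    have "L2_inner (torus N) f (G \<alpha>) = fourier_coeff N (\<lambda>\<zeta>. f \<zeta> * w \<zeta>) \<alpha>" for \<alpha>
      unfolding G(2)[OF f] unfolding fourier_coeff_eq_inner L2_inner_def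
      by (intro Bochner_Integration.integral_cong refl) (simp add: w_def mult_ac)
    moreover have "L2_normsq (torus N) (\<lambda>\<zeta>. f \<zeta> * w \<zeta>)
        = L2_normsq (torus N) f - L2_normsq (torus N) (\<lambda>\<zeta>. \<phi> \<zeta> * f \<zeta>)"
    proof -
      have i: "integrable (torus N) (\<lambda>\<zeta>. (cmod (f \<zeta>))\<^sup>2)"
        "integrable (torus N) (\<lambda>\<zeta>. (cmod (\<phi> \<zeta> * f \<zeta>))\<^sup>2)"
        by (intro L2_integrable_square H2_L2 f Hinf_mult_H2[OF \<phi>])+
      have "L2_normsq (torus N) (\<lambda>\<zeta>. f \<zeta> * w \<zeta>)
          = (LINT \<zeta>|torus N. (cmod (f \<zeta>))\<^sup>2 - (cmod (\<phi> \<zeta> * f \<zeta>))\<^sup>2)"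
      proof (rule integral_cong_AE)
        show "AE \<zeta> in torus N. (cmod (f \<zeta> * w \<zeta>))\<^sup>2 = (cmod (f \<zeta>))\<^sup>2 - (cmod (\<phi> \<zeta> * f \<zeta>))\<^sup>2"
          using lt
        proof eventually_elim
          case (elim \<zeta>)
          then have "(cmod (\<phi> \<zeta>))\<^sup>2 \<le> 1" by (simp add: power_le_one)
          then have w2: "(cmod (w \<zeta>))\<^sup>2 = 1 - (cmod (\<phi> \<zeta>))\<^sup>2" by (simp add: w_def)
          show ?case unfolding norm_mult power_mult_distrib w2 by (simp add: algebra_simps)
        qed
      qed (use i L2_integrable_square[OF fw] in auto)
      also have "\<dots> = L2_normsq (torus N) f - L2_normsq (torus N) (\<lambda>\<zeta>. \<phi> \<zeta> * f \<zeta>)"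
        by (rule Bochner_Integration.integral_diff[OF i])
      finally show ?thesis .
    qed
    ultimately show "((\<lambda>\<alpha>. (cmod (L2_inner (torus N) f (G \<alpha>)))\<^sup>2) has_sum
        (L2_normsq (torus N) f - L2_normsq (torus N) (\<lambda>\<zeta>. \<phi> \<zeta> * f \<zeta>))) (multi_indices N)"
      using parseval[OF fw] by simp
  qed
qed

text \<open>Applied to \<open>\<phi>\<^sup>n y\<close>, the family of the previous lemma turns the frame sum into the telescoping
  series of \<open>\<parallel>\<phi>\<^sup>n y\<parallel>\<^sup>2 - \<parallel>\<phi>\<^sup>n\<^sup>+\<^sup>1 y\<parallel>\<^sup>2\<close>, so both frame bounds can be taken to be \<open>1\<close>.\<close>

lemma less_1_imp_orbit_frame:
  assumes \<phi>: "\<phi> \<in> Hinf N" and lt: "AE \<zeta> in torus N. cmod (\<phi> \<zeta>) < 1"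
  shows "\<exists>(I :: nat set) g. orbit_frame N \<phi> I g"
proof -
  let ?nsq = "L2_normsq (torus N)"
  obtain G where G: "\<And>\<alpha>. G \<alpha> \<in> H2 N"
    "\<And>f. f \<in> H2 N \<Longrightarrow> ((\<lambda>\<alpha>. (cmod (L2_inner (torus N) f (G \<alpha>)))\<^sup>2) has_sum
      (?nsq f - ?nsq (\<lambda>\<zeta>. \<phi> \<zeta> * f \<zeta>))) (multi_indices N)"
    using defect_parseval_family[OF \<phi> lt] by blast
  define I where "I = to_nat_on (multi_indices N) ` multi_indices N"
  define g where "g i = G (from_nat_into (multi_indices N) i)" for i
  have gH: "g i \<in> H2 N" for i unfolding g_def by (rule G(1))
  have sum_g: "((\<lambda>i. (cmod (L2_inner (torus N) f (g i)))\<^sup>2) has_sum (?nsq f - ?nsq (\<lambda>\<zeta>. \<phi> \<zeta> * f \<zeta>))) I"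
    if "f \<in> H2 N" for f
    unfolding I_def has_sum_reindex[OF inj_on_to_nat_on[OF countable_multi_indices]]
    using G(2)[OF that]
    by (rule has_sum_cong[THEN iffD1, rotated]) (simp add: g_def countable_multi_indices)
  have frame_sum: "(orbit_coeff_sq N \<phi> g y has_sum ?nsq y) (I \<times> UNIV)" if y: "y \<in> H2 N" for y
  proof -
    define a where "a n = ?nsq (\<lambda>\<zeta>. \<phi> \<zeta> ^ n * y \<zeta>)" for n
    let ?f = "\<lambda>(n, i). orbit_coeff_sq N \<phi> g y (i, n)"
    have inner: "((\<lambda>i. ?f (n, i)) has_sum (a n - a (Suc n))) I" for n
      using sum_g[OF Hinf_power_mult_H2[OF \<phi> y, of n]]
      by (simp add: orbit_coeff_sq_def a_def mult.assoc)
    have "a \<longlonglongrightarrow> 0"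
      unfolding a_def by (rule L2_powers_tendsto_0[OF _ lt H2_L2[OF y]])
        (use \<phi> in \<open>auto simp: Hinf_def intro: L2_measurable H2_L2\<close>)
    then have "(\<lambda>n. a n - a (Suc n)) sums (a 0 - 0)" by (rule telescope_sums')
    moreover have "0 \<le> a n - a (Suc n)" for n
      by (rule has_sum_nonneg[OF inner]) (simp add: orbit_coeff_sq_nonneg)
    ultimately have outer: "((\<lambda>n. a n - a (Suc n)) has_sum a 0) UNIV"
      using sums_nonneg_imp_has_sum by fastforce
    have "?f summable_on UNIV \<times> I"
      by (rule summable_on_SigmaI[OF inner has_sum_imp_summable[OF outer]])
         (simp add: orbit_coeff_sq_nonneg)
    from has_sum_SigmaI[OF inner outer this] have "(?f has_sum a 0) (UNIV \<times> I)" .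
    then have "(orbit_coeff_sq N \<phi> g y has_sum a 0) (I \<times> UNIV)"
      by (subst has_sum_swap) simp
    then show ?thesis by (simp add: a_def)
  qed
  have "orbit_frame N \<phi> I g"
    unfolding orbit_frame_iff[OF \<phi>]
  proof (intro conjI ballI exI[of _ "1::real"])
    fix y assume y: "y \<in> H2 N"
    show "orbit_coeff_sq N \<phi> g y summable_on I \<times> UNIV"
      using frame_sum[OF y] by (rule has_sum_imp_summable)
    show "1 * ?nsq y \<le> infsum (orbit_coeff_sq N \<phi> g y) (I \<times> UNIV)"
      "infsum (orbit_coeff_sq N \<phi> g y) (I \<times> UNIV) \<le> 1 * ?nsq y"
      using infsumI[OF frame_sum[OF y]] by simp_all
  qed (auto simp: gH)
  then show ?thesis by blast
qed

theorem theorem2p9: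
  fixes N :: nat and \<phi> :: "(nat \<Rightarrow> complex) \<Rightarrow> complex"
  assumes "N \<ge> 1" and "\<phi> \<in> Hinf N"
  shows "((\<exists>(I :: nat set) g. orbit_frame N \<phi> I g) \<longleftrightarrow> (AE \<zeta> in torus N. cmod (\<phi> \<zeta>) < 1)) \<and>
    ((AE \<zeta> in torus N. cmod (\<phi> \<zeta>) < 1) \<longrightarrow>
       (\<forall>(I :: 'i set) g. orbit_frame N \<phi> I g \<longrightarrow> infinite I))"
  using orbit_frame_imp_less_1[OF assms(2)] less_1_imp_orbit_frame[OF assms(2)]
    orbit_frame_imp_infinite[OF assms] by blast

end
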